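(* Let $G$ be a 3-edge-connected cubic graph and let $D$ be a 2-regular subgraph of $G$ whose disjoint cycles are $D_1,\dots,D_l$ ($l\ge 1$). Then $\mathrm{Blowup}(G,D)$ and $\mathrm{SemiBlowup}(G,D)$ are not 3-edge colorable. Furthermore $$o(\mathrm{Blowup}(G,D))\ \ge\ r_3(\mathrm{Blowup}(G,D))\ \ge\ \sum_{i=1}^{l}\left\lceil \frac{|V(D_i)|}{2}\right\rceil$$ and $$o(\mathrm{SemiBlowup}(G,D))\ \ge\ r_3(\mathrm{SemiBlowup}(G,D))\ \ge\ \sum_{i=1}^{l}\left\lceil \frac{|V(D_i)|}{2}\right\rceil .$$
   Context: The oddness $o(H)$ of a bridgeless cubic graph $H$ is the minimum number of odd components (cycles of odd length) in any 2-factor of $H$. The resistance $r_3(H)$ of a cubic graph $H$ is the minimum number of edges whose removal from $H$ leaves a 3-edge-colorable graph. A multipole consists of vertices, edges, and semiedges; a semiedge is an edge incident to exactly one vertex, with its other end free. Connecting a semiedge to a vertex $v$ means attaching its free end to $v$; connecting two semiedges means joining their free ends so that they become one ordinary edge. The 4-pole $B$: take the Petersen graph and remove two adjacent vertices $x,y$, keeping the four edges from $\{x,y\}$ to the remaining 8 vertices as semiedges. The two semiedges coming from edges formerly incident to $x$ are called $a_1,a_2$, and the two coming from edges formerly incident to $y$ are called $b_1,b_2$. $\mathrm{SemiBlowup}(G,D)$: for every cycle $C=(v_1,\dots,v_k)$ of $D$ (indices modulo $k$), remove all edges $v_iv_{i+1}$ and add $k$ copies $B_1,\dots,B_k$ of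 $B$, with semiedges $a_1^i,a_2^i,b_1^i,b_2^i$ of $B_i$. For all $i\in\{1,\dots,k\}$, connect $v_i$ with the semiedge $b_1^i$, connect the semiedge $a_2^i$ with the semiedge $b_2^{i+1}$, and connect $a_1^i$ with $v_{i+1}$. $\mathrm{Blowup}(G,D)$: for every cycle $C=(v_1,\dots,v_k)$ of $D$ (indices modulo $k$), remove all edges $v_iv_{i+1}$ and add $k$ copies $B_1,\dots,B_k$ of $B$, with semiedges $a_1^i,a_2^i,b_1^i,b_2^i$ of $B_i$. For each $i\in\{1,\dots,k\}$ add two new vertices $u_i,w_i$ and the edges $v_iu_i$, $v_iw_i$, and connect $u_i$ with $b_1^i$, $w_i$ with $b_2^i$, $a_1^i$ with $u_{i+1}$, and $a_2^i$ with $w_{i+1}$. *)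

theory Defs
  imports Complex_Main "HOL-Library.Extended_Nat"
begin

section \<open>Finite loopless multigraphs\<close>

text \<open>
  Parallel edges are allowed, so that the 3-edge-connected cubic graph with two vertices and
  three parallel edges is covered.  Loops are excluded; a loop in a connected cubic graph is
  always attached to a bridge, so this is no restriction for 3-edge-connected cubic graphs.
\<close>

record ('v, 'e) multigraph =
  verts :: "'v set"
  edges :: "'e set"
  ends :: "'e \<Rightarrow> 'v set"

definition is_graph :: "('v, 'e) multigraph \<Rightarrow> bool" where
  "is_graph G \<longleftrightarrow> finite (verts G) \<and> finite (edges G) \<and>
     (\<forall>e\<in>edges G. ends G e \<subseteq> verts G \<and> card (ends G e) = 2)"

definition degree :: "('v, 'e) multigraph \<Rightarrow> 'v \<Rightarrow> nat" where
  "degree G v = card {e \<in> edges G. v \<in> ends G e}"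

definition regular :: "nat \<Rightarrow> ('v, 'e) multigraph \<Rightarrow> bool" where
  "regular k G \<longleftrightarrow> (\<forall>v\<in>verts G. degree G v = k)"

abbreviation cubic :: "('v, 'e) multigraph \<Rightarrow> bool" where
  "cubic G \<equiv> regular 3 G"

definition delete_edges :: "('v, 'e) multigraph \<Rightarrow> 'e set \<Rightarrow> ('v, 'e) multigraph" where
  "delete_edges G F = G\<lparr>edges := edges G - F\<rparr>"

definition subgraph :: "('v, 'e) multigraph \<Rightarrow> ('v, 'e) multigraph \<Rightarrow> bool" where
  "subgraph H G \<longleftrightarrow> is_graph H \<and> verts H \<subseteq> verts G \<and> edges H \<subseteq> edges G \<and>
     (\<forall>e\<in>edges H. ends H e = ends G e)"

definition adjacency :: "('v, 'e) multigraph \<Rightarrow> ('v \<times> 'v) set" where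
  "adjacency G = {(u, v). \<exists>e\<in>edges G. ends G e = {u, v}}"

definition connected_graph :: "('v, 'e) multigraph \<Rightarrow> bool" where
  "connected_graph G \<longleftrightarrow> verts G \<noteq> {} \<and> (\<forall>u\<in>verts G. \<forall>v\<in>verts G. (u, v) \<in> (adjacency G)\<^sup>*)"

definition graph_components :: "('v, 'e) multigraph \<Rightarrow> 'v set set" where
  "graph_components G = (\<lambda>u. {v \<in> verts G. (u, v) \<in> (adjacency G)\<^sup>*}) ` verts G"

definition edge_connected :: "nat \<Rightarrow> ('v, 'e) multigraph \<Rightarrow> bool" where
  "edge_connected k G \<longleftrightarrow> card (verts G) \<ge> 2 \<and>
     (\<forall>F\<subseteq>edges G. card F < k \<longrightarrow> connected_graph (delete_edges G F))"

section \<open>Edge colorings, resistance and oddness\<close>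

definition edge_colorable :: "nat \<Rightarrow> ('v, 'e) multigraph \<Rightarrow> bool" where
  "edge_colorable k G \<longleftrightarrow> (\<exists>c :: 'e \<Rightarrow> nat. (\<forall>e\<in>edges G. c e < k) \<and>
     (\<forall>e\<in>edges G. \<forall>f\<in>edges G. e \<noteq> f \<and> ends G e \<inter> ends G f \<noteq> {} \<longrightarrow> c e \<noteq> c f))"

definition resistance :: "('v, 'e) multigraph \<Rightarrow> nat" where
  "resistance G =
     (LEAST n. \<exists>F\<subseteq>edges G. card F = n \<and> edge_colorable 3 (delete_edges G F))"

definition two_factor :: "('v, 'e) multigraph \<Rightarrow> ('v, 'e) multigraph \<Rightarrow> bool" where
  "two_factor H G \<longleftrightarrow> subgraph H G \<and> verts H = verts G \<and> regular 2 H"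

text \<open>
  The components of a 2-factor are cycles, and the length of a cycle is its number of vertices.
  The infimum of a nonempty set of extended naturals is its minimum; it would be \<open>\<infinity>\<close> for a
  graph without 2-factors, but bridgeless cubic graphs always have one (Petersen's theorem).
\<close>

definition odd_components :: "('v, 'e) multigraph \<Rightarrow> 'v set set" where
  "odd_components H = {C \<in> graph_components H. odd (card C)}"

definition oddness :: "('v, 'e) multigraph \<Rightarrow> enat" where
  "oddness G = (INF H\<in>{H. two_factor H G}. enat (card (odd_components H)))"

section \<open>Cycles of a 2-regular graph\<close>

text \<open>
  A cycle \<open>(v\<^sub>1, \<dots>, v\<^sub>k)\<close> is the list of the pairs \<open>(v\<^sub>i, e\<^sub>i)\<close>, numbered from 0, where \<open>e\<^sub>i\<close> is its
  edge joining \<open>v\<^sub>i\<close> and \<open>v\<^sub>i\<^sub>+\<^sub>1\<close> (indices modulo \<open>k\<close>).  Two parallel edges form a cycle of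
  length 2.
\<close>

type_synonym ('v, 'e) cyc = "('v \<times> 'e) list"

definition cyc_verts :: "('v, 'e) cyc \<Rightarrow> 'v set" where
  "cyc_verts C = fst ` set C"

definition cyc_edges :: "('v, 'e) cyc \<Rightarrow> 'e set" where
  "cyc_edges C = snd ` set C"

definition is_cycle :: "('v, 'e) multigraph \<Rightarrow> ('v, 'e) cyc \<Rightarrow> bool" where
  "is_cycle G C \<longleftrightarrow> length C \<ge> 2 \<and> distinct (map fst C) \<and> distinct (map snd C) \<and>
     (\<forall>i<length C. snd (C ! i) \<in> edges G \<and>
        ends G (snd (C ! i)) = {fst (C ! i), fst (C ! (Suc i mod length C))})"

text \<open>
  \<open>Ds\<close> lists the cycles of \<open>D\<close>, each of them once, with an arbitrary choice of starting point
  and direction.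
\<close>

definition cycles_of :: "('v, 'e) multigraph \<Rightarrow> ('v, 'e) cyc list \<Rightarrow> bool" where
  "cycles_of D Ds \<longleftrightarrow> (\<forall>C\<in>set Ds. is_cycle D C) \<and>
     (\<forall>i<length Ds. \<forall>j<length Ds. i \<noteq> j \<longrightarrow> cyc_verts (Ds ! i) \<inter> cyc_verts (Ds ! j) = {}) \<and>
     verts D = (\<Union>C\<in>set Ds. cyc_verts C) \<and> edges D = (\<Union>C\<in>set Ds. cyc_edges C)"

section \<open>The 4-pole B\<close>

record ('v, 'e) multipole = "('v, 'e) multigraph" +
  semiedges :: "'e set"
  foot :: "'e \<Rightarrow> 'v"  \<comment> \<open>the vertex a semiedge is incident to\<close>

text \<open>Remove the vertices \<open>X\<close>; the edges leaving \<open>X\<close> become semiedges.\<close>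

definition sever :: "('v, 'e) multigraph \<Rightarrow> 'v set \<Rightarrow> ('v, 'e) multipole" where
  "sever G X = \<lparr>verts = verts G - X, edges = {e \<in> edges G. ends G e \<inter> X = {}}, ends = ends G,
     semiedges = {e \<in> edges G. card (ends G e \<inter> X) = 1},
     foot = (\<lambda>e. the_elem (ends G e - X))\<rparr>"

definition petersen :: "(nat, nat set) multigraph" where
  "petersen = \<lparr>verts = {..<10},
     edges = {{i, Suc i mod 5} | i. i < 5} \<union> {{i, i + 5} | i. i < 5} \<union>
             {{i + 5, (i + 2) mod 5 + 5} | i. i < 5},
     ends = (\<lambda>e. e)\<rparr>"

text \<open>
  We take \<open>x = 0\<close> and \<open>y = 5\<close>.  The automorphisms of the Petersen graph act transitively on
  the ordered pairs \<open>(x, y)\<close> of adjacent vertices, and those fixing \<open>x\<close> and \<open>y\<close> induce all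
  four ways of naming the semiedges, so these choices are immaterial.
\<close>

definition pole_B :: "(nat, nat set) multipole" where
  "pole_B = sever petersen {0, 5}"

definition semi_a1 :: "nat set" where "semi_a1 = {0, 1}"
definition semi_a2 :: "nat set" where "semi_a2 = {0, 4}"
definition semi_b1 :: "nat set" where "semi_b1 = {5, 7}"
definition semi_b2 :: "nat set" where "semi_b2 = {5, 8}"

section \<open>Blowup and SemiBlowup\<close>

text \<open>
  The pair \<open>(j, i)\<close> stands for position \<open>i\<close> on the \<open>j\<close>-th cycle.  \<open>InCopy j i p\<close> is the vertex
  \<open>p\<close> of the copy \<open>B\<^sub>i\<close> added for that cycle.  An added edge, including one obtained by connecting
  semiedges, is named by its set of ends; no two added edges are parallel.
\<close>

datatype 'v blow_vert = Old 'v | InCopy nat nat nat | NewU nat nat | NewW nat nat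

datatype ('v, 'e) blow_edge = Kept 'e | Added "'v blow_vert set"

definition blow_ends :: "('v, 'e) multigraph \<Rightarrow> ('v, 'e) blow_edge \<Rightarrow> 'v blow_vert set" where
  "blow_ends G x = (case x of Kept e \<Rightarrow> Old ` ends G e | Added X \<Rightarrow> X)"

definition positions :: "('v, 'e) cyc list \<Rightarrow> (nat \<times> nat) set" where
  "positions Ds = {(j, i). j < length Ds \<and> i < length (Ds ! j)}"

definition next_pos :: "('v, 'e) cyc list \<Rightarrow> nat \<Rightarrow> nat \<Rightarrow> nat" where
  "next_pos Ds j i = Suc i mod length (Ds ! j)"

definition vert_at :: "('v, 'e) cyc list \<Rightarrow> nat \<Rightarrow> nat \<Rightarrow> 'v blow_vert" where
  "vert_at Ds j i = Old (fst (Ds ! j ! i))"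

definition copy_foot :: "nat \<Rightarrow> nat \<Rightarrow> nat set \<Rightarrow> 'v blow_vert" where
  "copy_foot j i s = InCopy j i (foot pole_B s)"

definition copy_verts :: "nat \<Rightarrow> nat \<Rightarrow> 'v blow_vert set" where
  "copy_verts j i = InCopy j i ` verts pole_B"

definition copy_edges :: "nat \<Rightarrow> nat \<Rightarrow> 'v blow_vert set set" where
  "copy_edges j i = (\<lambda>e. InCopy j i ` ends pole_B e) ` edges pole_B"

definition SemiBlowup ::
  "('v, 'e) multigraph \<Rightarrow> ('v, 'e) cyc list \<Rightarrow> ('v blow_vert, ('v, 'e) blow_edge) multigraph" where
  "SemiBlowup G Ds = \<lparr>
     verts = Old ` verts G \<union> (\<Union>(j, i)\<in>positions Ds. copy_verts j i),
     edges = Kept ` (edges G - (\<Union>C\<in>set Ds. cyc_edges C)) \<union>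
       Added ` (\<Union>(j, i)\<in>positions Ds. copy_edges j i \<union>
         {{vert_at Ds j i, copy_foot j i semi_b1},
          {copy_foot j i semi_a2, copy_foot j (next_pos Ds j i) semi_b2},
          {copy_foot j i semi_a1, vert_at Ds j (next_pos Ds j i)}}),
     ends = blow_ends G\<rparr>"

definition Blowup ::
  "('v, 'e) multigraph \<Rightarrow> ('v, 'e) cyc list \<Rightarrow> ('v blow_vert, ('v, 'e) blow_edge) multigraph" where
  "Blowup G Ds = \<lparr>
     verts = Old ` verts G \<union>
       (\<Union>(j, i)\<in>positions Ds. copy_verts j i \<union> {NewU j i, NewW j i}),
     edges = Kept ` (edges G - (\<Union>C\<in>set Ds. cyc_edges C)) \<union>
       Added ` (\<Union>(j, i)\<in>positions Ds. copy_edges j i \<union>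
         {{vert_at Ds j i, NewU j i},
          {vert_at Ds j i, NewW j i},
          {NewU j i, copy_foot j i semi_b1},
          {NewW j i, copy_foot j i semi_b2},
          {copy_foot j i semi_a1, NewU j (next_pos Ds j i)},
          {copy_foot j i semi_a2, NewW j (next_pos Ds j i)}}),
     ends = blow_ends G\<rparr>"

end

theory Submission
  imports Defs "HOL-Library.Disjoint_Sets"
begin

text \<open>
  The Petersen graph is not 3-edge-colorable, so a 3-edge-coloring of the 4-pole B gives \<open>a\<^sub>1\<close>
  and \<open>a\<^sub>2\<close> the same color, and likewise \<open>b\<^sub>1\<close> and \<open>b\<^sub>2\<close>.  Hence two consecutive copies of B, together with the
  connecting edges between them, cannot be colored: in the SemiBlowup, the two added edges at the
  cycle vertex between the copies would both have the color of the edge joining \<open>a\<^sub>2\<close> to \<open>b\<^sub>2\<close>; in the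
  Blowup, both edges \<open>vu\<close> and \<open>vw\<close> would need the third color.  Deleting edges must therefore hit
  each of these \<open>k\<close> zones of a cycle of length \<open>k\<close>, and no edge lies in more than two of them.

  For the other inequality, color the cycles of a 2-factor alternately with two colors after
  deleting one edge of each odd cycle, and give the remaining edges, which form a matching, the
  third color.
\<close>

section \<open>Oddness bounds resistance\<close>

text \<open>An intact zone says nothing about the semiedges on the far sides of its two copies: they
  belong to neighboring zones and may have been deleted. The statement about B is therefore made for
  its ten inner edges alone. Two of them meet at each foot of a semiedge and leave exactly one
  missing color there, so deleted semiedges can be imagined back.

  With all four semiedges present, each color class covers the 8 vertices of B, so each color occurs
  an even number of times among the semiedges. If the colors at \<open>a1\<close> and
  \<open>a2\<close> differed, they would recur at \<open>b1\<close> and \<open>b2\<close>, and the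
  third color on the removed edge \<open>xy\<close> would complete a coloring of the Petersen graph.
  The code replaces this argument by a finite case analysis that shows directly which missing colors
  agree.

  The bound can be rounded up on every cycle separately because the zones of different cycles share
  no edge.\<close>

definition edge_coloring :: "nat \<Rightarrow> ('v, 'e) multigraph \<Rightarrow> ('e \<Rightarrow> nat) \<Rightarrow> bool" where
  "edge_coloring k G c \<longleftrightarrow> (\<forall>e\<in>edges G. c e < k) \<and>
     (\<forall>e\<in>edges G. \<forall>f\<in>edges G. e \<noteq> f \<and> ends G e \<inter> ends G f \<noteq> {} \<longrightarrow> c e \<noteq> c f)"

lemma edge_colorable_iff: "edge_colorable k G \<longleftrightarrow> (\<exists>c. edge_coloring k G c)"
  by (simp add: edge_colorable_def edge_coloring_def)

lemma delete_edges_simps [simp]: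
  "verts (delete_edges G F) = verts G"
  "edges (delete_edges G F) = edges G - F"
  "ends (delete_edges G F) = ends G"
  by (simp_all add: delete_edges_def)

section \<open>Components of a 2-regular multigraph are cycles\<close>

definition incident :: "('v, 'e) multigraph \<Rightarrow> 'v \<Rightarrow> 'e set" where
  "incident G v = {e \<in> edges G. v \<in> ends G e}"

definition component :: "('v, 'e) multigraph \<Rightarrow> 'v \<Rightarrow> 'v set" where
  "component G v = {u \<in> verts G. (v, u) \<in> (adjacency G)\<^sup>*}"

lemma finite_incident: "is_graph G \<Longrightarrow> finite (incident G v)"
  by (simp add: is_graph_def incident_def)

lemma ends_eqE:
  assumes "is_graph G" "e \<in> edges G" "v \<in> ends G e"
  obtains w where "ends G e = {v, w}" "w \<noteq> v" "w \<in> verts G"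
proof -
  have "card (ends G e) = 2" "ends G e \<subseteq> verts G" using assms by (auto simp: is_graph_def)
  then obtain w where "ends G e = {v, w}" "w \<noteq> v"
    using assms(3) by (auto simp: card_2_iff doubleton_eq_iff)
  then show ?thesis using \<open>ends G e \<subseteq> verts G\<close> that by auto
qed

lemma incident_regular_2:
  assumes "is_graph G" "regular 2 G" "v \<in> verts G"
    and "a \<in> incident G v" "b \<in> incident G v" "a \<noteq> b"
  shows "incident G v = {a, b}"
proof -
  have "card (incident G v) = 2"
    using assms(2,3) by (simp add: regular_def degree_def incident_def)
  moreover have "card {a, b} = 2" using \<open>a \<noteq> b\<close> by simp
  ultimately have "{a, b} = incident G v"
    using assms by (intro card_subset_eq finite_incident) auto
  then show ?thesis by simp
qed

lemma adjacency_sym: "sym (adjacency G)"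
  by (auto simp: adjacency_def sym_def insert_commute)

lemma component_eq:
  assumes "(u, v) \<in> (adjacency G)\<^sup>*"
  shows "component G u = component G v"
  using assms symD[OF sym_rtrancl[OF adjacency_sym] assms]
  by (auto simp: component_def intro: rtrancl_trans)

text \<open>The cycle is found by closing up a longest path that starts at the given vertex.\<close>

lemma regular_2_component:
  assumes G: "is_graph G" and reg: "regular 2 G" and v: "v \<in> verts G"
  obtains m p e where "inj_on p {..m}" "inj_on e {..m}"
    "\<And>i. i \<le> m \<Longrightarrow> e i \<in> edges G"
    "\<And>i. i \<le> m \<Longrightarrow> ends G (e i) = {p i, p (Suc i mod Suc m)}"
    "p ` {..m} = component G v" "(\<Union>u\<in>component G v. incident G u) = e ` {..m}"
proof -
  define P where "P m p e \<longleftrightarrow> p 0 = v \<and> inj_on p {..m} \<and>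
    (\<forall>i<m. e i \<in> edges G \<and> ends G (e i) = {p i, p (Suc i)})" for m :: nat and p e
  have finV: "finite (verts G)" using G by (simp add: is_graph_def)
  have P_verts: "p i \<in> verts G" if "P m p e" "i \<le> m" for m p e i
  proof (cases i)
    case 0
    then show ?thesis using that v by (simp add: P_def)
  next
    case (Suc j)
    then have "p i \<in> ends G (e j)" "e j \<in> edges G" using that by (auto simp: P_def)
    then show ?thesis using G by (auto simp: is_graph_def)
  qed
  have bound: "m < card (verts G)" if ex: "\<exists>p e. P m p e" for m
  proof -
    obtain p e where Pm: "P m p e" using ex by blast
    have "card (p ` {..m}) \<le> card (verts G)"
      using P_verts[OF Pm] finV by (intro card_mono) auto
    then show ?thesis using Pm by (simp add: P_def card_image)
  qed
  \<comment> \<open>The one-vertex path starts the maximization; the number of vertices bounds it,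
    so a greatest \<open>m\<close> exists.\<close>
  have "P 0 (\<lambda>_. v) e" for e by (simp add: P_def)
  then obtain m where ex: "\<exists>p e. P m p e" and max: "\<And>m'. \<exists>p e. P m' p e \<Longrightarrow> m' \<le> m"
    using GreatestI_nat[of "\<lambda>m. \<exists>p e. P m p e" 0 "card (verts G)"]
      Greatest_le_nat[of "\<lambda>m. \<exists>p e. P m p e" _ "card (verts G)"] bound
    by (metis (no_types, lifting) less_imp_le)
  from ex obtain p e where Pm: "P m p e" by blast
  have p0: "p 0 = v" and inj: "inj_on p {..m}"
    and e: "\<And>i. i < m \<Longrightarrow> e i \<in> edges G" "\<And>i. i < m \<Longrightarrow> ends G (e i) = {p i, p (Suc i)}"
    using Pm by (auto simp: P_def)
  have p_eq: "p i = p j \<longleftrightarrow> i = j" if "i \<le> m" "j \<le> m" for i j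
    using inj that by (auto simp: inj_on_def)
  \<comment> \<open>Maximality: an edge from the last vertex to a new vertex would lengthen the
    path.\<close>
  have noext: "z \<in> p ` {..m}" if "f \<in> edges G" "ends G f = {p m, z}" for f z
  proof (rule ccontr)
    assume z: "z \<notin> p ` {..m}"
    have "P (Suc m) (p(Suc m := z)) (e(m := f))"
      unfolding P_def
    proof (intro conjI allI impI)
      show "inj_on (p(Suc m := z)) {..Suc m}"
        using inj z by (auto simp: inj_on_def atMost_Suc)
    qed (use p0 e that in \<open>auto simp: less_Suc_eq\<close>)
    then have "Suc m \<le> m" using max by blast
    then show False by simp
  qed
  have deg: "card (incident G u) = 2" if "u \<in> verts G" for u
    using reg that by (simp add: regular_def degree_def incident_def)
  have other: "\<exists>f \<in> incident G u. f \<noteq> g" if "u \<in> verts G" for u g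
  proof (rule ccontr)
    assume "\<not> ?thesis"
    then have "incident G u \<subseteq> {g}" by blast
    then have "card (incident G u) \<le> card {g}" by (intro card_mono) auto
    then show False using deg[OF that] by simp
  qed
  have pm: "p m \<in> verts G" using P_verts[OF Pm] by simp
  have "m \<noteq> 0"
  proof
    assume "m = 0"
    obtain f where "f \<in> incident G v" using other[OF v] by blast
    then obtain z where "f \<in> edges G" "ends G f = {v, z}" "z \<noteq> v"
      using ends_eqE[OF G, of f v] by (auto simp: incident_def)
    with noext[of f z] \<open>m = 0\<close> p0 show False by auto
  qed
  \<comment> \<open>Since \<open>m\<close> is not 0, \<open>e (m - 1)\<close> is the path edge at
    the last vertex, and \<open>f\<close> is the second edge there. Its other end lies on the path
    by \<open>noext\<close>.\<close>
  obtain f where f: "f \<in> incident G (p m)" "f \<noteq> e (m - 1)" using other[OF pm] by blast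
  then obtain z where f': "f \<in> edges G" "ends G f = {p m, z}" "z \<noteq> p m"
    using ends_eqE[OF G, of f "p m"] by (auto simp: incident_def)
  then obtain k where k: "z = p k" "k \<le> m" "k \<noteq> m" using noext[of f z] by auto
  \<comment> \<open>An inner path vertex already has its two edges on the path, so \<open>f\<close>
    would be one of them. A path edge at \<open>p m\<close> can only be \<open>e (m - 1)\<close>,
    which the choice of \<open>f\<close> excludes.\<close>
  have "k = 0"
  proof (rule ccontr)
    assume "k \<noteq> 0"
    then obtain j where j: "k = Suc j" by (cases k) auto
    have ej: "ends G (e j) = {p j, p k}" "ends G (e k) = {p k, p (Suc k)}"
      using e j k by auto
    have "e j \<noteq> e k" using ej p_eq[of j k] p_eq[of j "Suc k"] j k by (auto simp: doubleton_eq_iff)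
    then have "incident G (p k) = {e j, e k}"
      using e j k P_verts[OF Pm, of k] ej
      by (intro incident_regular_2[OF G reg]) (auto simp: incident_def)
    moreover have "f \<in> incident G (p k)" using f' k by (auto simp: incident_def)
    ultimately consider "f = e j" | "f = e k" by blast
    then show False
    proof cases
      case 1
      then show False using f' ej p_eq[of m j] p_eq[of m k] j k by auto
    next
      case 2
      then have "p m \<in> {p k, p (Suc k)}" using f' ej by auto
      then have "m = Suc k" using p_eq[of m k] p_eq[of m "Suc k"] k by auto
      then show False using 2 f by simp
    qed
  qed
  define e' where "e' = e(m := f)"
  have e'_edge: "e' i \<in> edges G" if "i \<le> m" for i
    using that e f' by (auto simp: e'_def)
  have e'_ends: "ends G (e' i) = {p i, p (Suc i mod Suc m)}" if "i \<le> m" for i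
    using that e f' k \<open>k = 0\<close> by (auto simp: e'_def)
  \<comment> \<open>Ends alone do not suffice: for \<open>m = 1\<close> the closing edge
    \<open>f\<close> is parallel to \<open>e 0\<close>. Equal ends force \<open>m = Suc i\<close>,
    and that case is excluded by the choice of \<open>f\<close>.\<close>
  have f_neq: "f \<noteq> e i" if "i < m" for i
  proof
    assume "f = e i"
    then have "{p m, p 0} = {p i, p (Suc i)}" using e(2)[OF that] f' k \<open>k = 0\<close> by simp
    then have "m = Suc i"
      using that p_eq[of m i] p_eq[of m "Suc i"] by (auto simp: doubleton_eq_iff)
    then show False using \<open>f = e i\<close> f by simp
  qed
  have e_neq: "e i \<noteq> e j" if "i < j" "j < m" for i j
  proof
    assume "e i = e j"
    then have "{p i, p (Suc i)} = {p j, p (Suc j)}" using e(2)[of i] e(2)[of j] that by simp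
    then show False using that p_eq[of i j] p_eq[of i "Suc j"] by (auto simp: doubleton_eq_iff)
  qed
  have e'_inj: "inj_on e' {..m}"
  proof (rule linorder_inj_onI)
    fix i j assume "i < j" "i \<in> {..m}" "j \<in> {..m}"
    then show "e' i \<noteq> e' j" using e_neq[of i j] f_neq[of i] by (auto simp: e'_def)
  qed auto
  have inc: "incident G (p i) \<subseteq> e' ` {..m}" if "i \<le> m" for i
  proof -
    \<comment> \<open>The cyclic predecessor of \<open>i\<close>. The edges with indices
      \<open>h\<close> and \<open>i\<close> are distinct, so by 2-regularity they are all the edges
      at \<open>p i\<close>.\<close>
    define h where "h = (if i = 0 then m else i - 1)"
    have h: "h \<le> m" "h \<noteq> i" "Suc h mod Suc m = i"
      using that \<open>m \<noteq> 0\<close> by (auto simp: h_def)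
    then have "e' h \<noteq> e' i" using e'_inj that by (auto simp: inj_on_def)
    moreover have "e' h \<in> incident G (p i)" "e' i \<in> incident G (p i)"
      using e'_edge e'_ends h that by (auto simp: incident_def)
    ultimately have "incident G (p i) = {e' i, e' h}"
      using P_verts[OF Pm that] by (intro incident_regular_2[OF G reg]) auto
    then show ?thesis using h that by auto
  qed
  have comp: "p ` {..m} = component G v"
  proof
    have "(v, p i) \<in> (adjacency G)\<^sup>*" if "i \<le> m" for i
      using that
    proof (induction i)
      case 0
      then show ?case by (simp add: p0)
    next
      case (Suc i)
      then have "(p i, p (Suc i)) \<in> adjacency G" using e[of i] by (auto simp: adjacency_def)
      then show ?case using Suc by (simp add: rtrancl.rtrancl_into_rtrancl)
    qed
    then show "p ` {..m} \<subseteq> component G v" using P_verts[OF Pm] by (auto simp: component_def)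
    \<comment> \<open>No edge leaves the closed path, because every edge at one of its vertices is
      among the \<open>e' j\<close>.\<close>
    have "u \<in> p ` {..m}" if "(v, u) \<in> (adjacency G)\<^sup>*" for u
      using that
    proof (induction rule: rtrancl_induct)
      case base
      then show ?case using p0 by force
    next
      case (step y z)
      then obtain i where i: "y = p i" "i \<le> m" by auto
      obtain g where g: "g \<in> edges G" "ends G g = {y, z}"
        using step by (auto simp: adjacency_def)
      then obtain j where "g = e' j" "j \<le> m" using inc[OF i(2)] i by (auto simp: incident_def)
      then have "z \<in> {p j, p (Suc j mod Suc m)}" using e'_ends[of j] g by auto
      moreover have "Suc j mod Suc m \<le> m" by (simp add: less_Suc_eq_le[symmetric])
      ultimately show ?case using \<open>j \<le> m\<close> by auto
    qed
    then show "component G v \<subseteq> p ` {..m}" by (auto simp: component_def)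
  qed
  have "(\<Union>u\<in>component G v. incident G u) = e' ` {..m}"
  proof
    show "(\<Union>u\<in>component G v. incident G u) \<subseteq> e' ` {..m}"
      using inc unfolding comp[symmetric] by (simp add: UN_subset_iff)
    show "e' ` {..m} \<subseteq> (\<Union>u\<in>component G v. incident G u)"
      using e'_edge e'_ends unfolding comp[symmetric] by (auto simp: incident_def)
  qed
  with inj e'_inj e'_edge e'_ends comp show ?thesis by (rule that)
qed

section \<open>Coloring 2-regular graphs and cubic graphs after deletions\<close>

lemma component_coloring:
  assumes "is_graph G" "regular 2 G" "C \<in> graph_components G"
  obtains F c where "F \<subseteq> edges G" "card F \<le> (if odd (card C) then 1 else 0)"
    "\<And>e. c e < (2::nat)"
    "\<And>e f u. \<lbrakk>e \<in> incident G u - F; f \<in> incident G u - F; u \<in> C; e \<noteq> f\<rbrakk> \<Longrightarrow> c e \<noteq> c f"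
proof -
  obtain v where v: "v \<in> verts G" "C = component G v"
    using assms(3) by (auto simp: graph_components_def component_def)
  obtain m p e where inj: "inj_on p {..m}" "inj_on e {..m}"
    and edge: "\<And>i. i \<le> m \<Longrightarrow> e i \<in> edges G"
    and ends: "\<And>i. i \<le> m \<Longrightarrow> ends G (e i) = {p i, p (Suc i mod Suc m)}"
    and C: "p ` {..m} = component G v" "(\<Union>u\<in>component G v. incident G u) = e ` {..m}"
    using regular_2_component[OF assms(1,2) v(1)] by metis
  \<comment> \<open>The indices run from 0 to \<open>m\<close>, so the cycle has length
    \<open>Suc m\<close> and is odd exactly when \<open>m\<close> is even; then its closing edge is
    removed.\<close>
  define F where "F = (if even m then {e m} else {})"
  \<comment> \<open>The parity of the index of an edge on the cycle. Edges of other components get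
    an arbitrary value, which is still below 2.\<close>
  define c where "c x = inv_into {..m} e x mod 2" for x
  have c_e: "c (e i) = i mod 2" if "i \<le> m" for i using that inj by (simp add: c_def)
  have p_eq: "p i = p j \<longleftrightarrow> i = j" if "i \<le> m" "j \<le> m" for i j
    using inj that by (auto simp: inj_on_def)
  have card: "card C = Suc m" using C inj v by (metis card_image card_atMost)
  have proper: "c (e i) \<noteq> c (e j)"
    if "i < j" "j \<le> m" "e j \<notin> F" "u \<in> ends G (e i)" "u \<in> ends G (e j)" for i j u
  proof -
    have "u = p i \<or> u = p (Suc i)" "u = p j \<or> u = p (if j = m then 0 else Suc j)"
      using that ends[of i] ends[of j] by (auto split: if_splits)
    \<comment> \<open>Distinct edges of the cycle that share a vertex have consecutive indices, or
      they are the first and the closing one. In the latter case the closing edge has survived, so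
      \<open>m\<close> is odd and the parities differ.\<close>
    then have "j = Suc i \<or> (j = m \<and> i = 0)"
      using that p_eq[of i j] p_eq[of "Suc i" j] p_eq[of i 0] p_eq[of "Suc i" 0]
        p_eq[of i "Suc j"] p_eq[of "Suc i" "Suc j"] by (auto split: if_splits)
    then show ?thesis
    proof
      assume "j = Suc i"
      then show ?thesis using that c_e[of i] c_e[of j] by (simp add: mod_Suc)
    next
      assume "j = m \<and> i = 0"
      moreover from this have "odd m" using that by (auto simp: F_def split: if_splits)
      ultimately show ?thesis using c_e[of i] c_e[of j] by (simp add: odd_iff_mod_2_eq_one)
    qed
  qed
  show ?thesis
  proof
    show "F \<subseteq> edges G" "card F \<le> (if odd (card C) then 1 else 0)"
      using edge card by (auto simp: F_def)
    show "c x < 2" for x by (simp add: c_def)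
    fix x y u assume x: "x \<in> incident G u - F" and y: "y \<in> incident G u - F"
      and u: "u \<in> C" and "x \<noteq> y"
    then have "x \<in> e ` {..m}" "y \<in> e ` {..m}" using C v by blast+
    then obtain i j where ij: "x = e i" "y = e j" "i \<le> m" "j \<le> m" by auto
    have ux: "u \<in> ends G (e i)" "u \<in> ends G (e j)" using x y ij by (auto simp: incident_def)
    have "i \<noteq> j" using \<open>x \<noteq> y\<close> ij by auto
    then show "c x \<noteq> c y"
      using proper[of i j u] proper[of j i u] ij x y ux by (auto simp: neq_iff)
  qed
qed

lemma finite_graph_components: "is_graph G \<Longrightarrow> finite (graph_components G)"
  by (simp add: graph_components_def is_graph_def)

text \<open>Edges that share a vertex lie in the same component, so the colorings of the components
  can be chosen independently and combined. The deleted sets add up to at most one edge per odd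
  component.\<close>

lemma regular_2_coloring:
  assumes G: "is_graph G" and reg: "regular 2 G"
  obtains F c where "F \<subseteq> edges G" "card F \<le> card (odd_components G)"
    "edge_coloring 2 (delete_edges G F) c"
proof -
  have "\<forall>C\<in>graph_components G. \<exists>F c. F \<subseteq> edges G \<and> card F \<le> (if odd (card C) then 1 else 0) \<and>
     (\<forall>e. c e < (2::nat)) \<and>
     (\<forall>e f u. e \<in> incident G u - F \<and> f \<in> incident G u - F \<and> u \<in> C \<and> e \<noteq> f \<longrightarrow> c e \<noteq> c f)"
    using component_coloring[OF G reg] by (intro ballI) metis
  from bchoice[OF this] obtain F where "\<forall>C\<in>graph_components G. \<exists>c. F C \<subseteq> edges G \<and>
     card (F C) \<le> (if odd (card C) then 1 else 0) \<and> (\<forall>e. c e < (2::nat)) \<and>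
     (\<forall>e f u. e \<in> incident G u - F C \<and> f \<in> incident G u - F C \<and> u \<in> C \<and> e \<noteq> f \<longrightarrow> c e \<noteq> c f)"
    by blast
  from bchoice[OF this] obtain c where Fc: "\<forall>C\<in>graph_components G. F C \<subseteq> edges G \<and>
     card (F C) \<le> (if odd (card C) then 1 else 0) \<and> (\<forall>e. c C e < (2::nat)) \<and>
     (\<forall>e f u. e \<in> incident G u - F C \<and> f \<in> incident G u - F C \<and> u \<in> C \<and> e \<noteq> f \<longrightarrow> c C e \<noteq> c C f)"
    by blast
  then have F: "\<And>C. C \<in> graph_components G \<Longrightarrow> F C \<subseteq> edges G"
    "\<And>C. C \<in> graph_components G \<Longrightarrow> card (F C) \<le> (if odd (card C) then 1 else 0)"
    and c: "\<And>C e. C \<in> graph_components G \<Longrightarrow> c C e < (2::nat)"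
    "\<And>C e f u. \<lbrakk>C \<in> graph_components G; e \<in> incident G u - F C; f \<in> incident G u - F C;
       u \<in> C; e \<noteq> f\<rbrakk> \<Longrightarrow> c C e \<noteq> c C f"
    by blast+
  \<comment> \<open>For an edge \<open>e\<close> this is the component containing both of its ends,
    hence it selects the coloring to be used on \<open>e\<close>. Adjacent edges select the same
    one.\<close>
  define K where "K e = {u \<in> verts G. \<exists>x\<in>ends G e. (x, u) \<in> (adjacency G)\<^sup>*}" for e
  have K: "K e = component G x" if e: "e \<in> edges G" "x \<in> ends G e" for e x
  proof -
    obtain w where w: "ends G e = {x, w}" using ends_eqE[OF G e] by metis
    then have "(x, w) \<in> adjacency G" using e by (auto simp: adjacency_def)
    then have "component G x = component G w" by (intro component_eq) auto
    then show ?thesis using w by (auto simp: K_def component_def)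
  qed
  have in_comp: "component G x \<in> graph_components G" if "x \<in> verts G" for x
    using that by (auto simp: graph_components_def component_def)
  have vert: "x \<in> verts G" if "e \<in> edges G" "x \<in> ends G e" for e x
    using G that by (auto simp: is_graph_def)
  define F' where "F' = (\<Union>C\<in>graph_components G. F C)"
  show ?thesis
  proof
    show "F' \<subseteq> edges G" using F by (auto simp: F'_def)
    have "card F' \<le> (\<Sum>C\<in>graph_components G. card (F C))"
      unfolding F'_def by (intro card_UN_le finite_graph_components G)
    also have "\<dots> \<le> (\<Sum>C\<in>graph_components G. if odd (card C) then 1 else 0)"
      by (intro sum_mono F)
    also have "\<dots> = card (odd_components G)"
      using finite_graph_components[OF G]
      by (simp add: odd_components_def sum.If_cases Int_def)
    finally show "card F' \<le> card (odd_components G)" .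
    show "edge_coloring 2 (delete_edges G F') (\<lambda>e. c (K e) e)"
      unfolding edge_coloring_def
    proof (intro conjI ballI impI; simp)
      fix e assume e: "e \<in> edges G \<and> e \<notin> F'"
      then obtain x where "x \<in> ends G e"
        using G by (force simp: is_graph_def card_2_iff)
      then show "c (K e) e < 2" using c(1)[OF in_comp[OF vert[of e x]]] K[of e x] e by simp
    next
      fix e f assume e: "e \<in> edges G \<and> e \<notin> F'" and f: "f \<in> edges G \<and> f \<notin> F'"
        and ef: "e \<noteq> f \<and> ends G e \<inter> ends G f \<noteq> {}"
      then obtain x where x: "x \<in> ends G e" "x \<in> ends G f" by blast
      have C: "component G x \<in> graph_components G" using in_comp vert e x by blast
      have "c (component G x) e \<noteq> c (component G x) f"
        using e f x ef C vert by (intro c(2)[OF C, of _ x])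
          (auto simp: incident_def F'_def component_def)
      then show "c (K e) e \<noteq> c (K f) f" using K e f x by simp
    qed
  qed
qed

text \<open>A 2-factor takes two edges at every vertex, so the degree bound leaves at most one edge
  outside it: these edges form a matching and can share the color 2. For a graph without 2-factors
  the oddness is infinite and the bound is trivial.\<close>

theorem resistance_le_oddness:
  assumes G: "is_graph G" and deg: "\<And>v. v \<in> verts G \<Longrightarrow> degree G v \<le> 3"
  shows "enat (resistance G) \<le> oddness G"
  unfolding oddness_def
proof (rule INF_greatest)
  fix H assume "H \<in> {H. two_factor H G}"
  then have H: "is_graph H" "regular 2 H" "verts H = verts G" "edges H \<subseteq> edges G"
    "\<And>e. e \<in> edges H \<Longrightarrow> ends H e = ends G e"
    by (auto simp: two_factor_def subgraph_def)
  obtain F c where F: "F \<subseteq> edges H" "card F \<le> card (odd_components H)"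
    and c: "edge_coloring 2 (delete_edges H F) c"
    using regular_2_coloring[OF H(1,2)] .
  define c' where "c' e = (if e \<in> edges H then c e else 2)" for e
  \<comment> \<open>Two such edges together with the two edges of \<open>H\<close> would give
    \<open>x\<close> degree at least 4.\<close>
  have unique: "e = f" if "e \<in> edges G - edges H" "f \<in> edges G - edges H"
    "x \<in> ends G e" "x \<in> ends G f" for e f x
  proof (rule ccontr)
    assume "e \<noteq> f"
    have x: "x \<in> verts G" using G that by (auto simp: is_graph_def)
    have "card (incident H x) = 2"
      using H x by (simp add: regular_def degree_def incident_def)
    moreover have "finite (incident H x)" using H by (intro finite_incident)
    moreover have "e \<notin> incident H x" "f \<notin> incident H x" using that by (auto simp: incident_def)
    ultimately have "card ({e, f} \<union> incident H x) = 4" using \<open>e \<noteq> f\<close> by simp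
    moreover have "{e, f} \<union> incident H x \<subseteq> incident G x"
      using that H by (auto simp: incident_def)
    ultimately have "4 \<le> card (incident G x)" using finite_incident[OF G] by (metis card_mono)
    then show False using deg[OF x] by (simp add: incident_def degree_def)
  qed
  have "edge_coloring 3 (delete_edges G F) c'"
    unfolding edge_coloring_def
  proof (intro conjI ballI impI; simp)
    fix e assume "e \<in> edges G \<and> e \<notin> F"
    then show "c' e < 3" using c by (force simp: edge_coloring_def c'_def)
  next
    fix e f assume e: "e \<in> edges G \<and> e \<notin> F" and f: "f \<in> edges G \<and> f \<notin> F"
      and ef: "e \<noteq> f \<and> ends G e \<inter> ends G f \<noteq> {}"
    then obtain x where x: "x \<in> ends G e" "x \<in> ends G f" by blast
    have lt: "c e < 2" if "e \<in> edges H" "e \<notin> F" for e using c that by (simp add: edge_coloring_def)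
    show "c' e \<noteq> c' f"
    proof (cases "e \<in> edges H \<longleftrightarrow> f \<in> edges H")
      case True
      then have "e \<in> edges H" "f \<in> edges H" using unique[of e f x] e f x ef by blast+
      then show ?thesis using c e f ef H(5) by (simp add: edge_coloring_def c'_def)
    next
      case False
      then show ?thesis using lt[of e] lt[of f] e f by (auto simp: c'_def)
    qed
  qed
  then have "resistance G \<le> card F"
    unfolding resistance_def using F H
    by (intro Least_le exI[of _ F]) (auto simp: edge_colorable_iff)
  then show "enat (resistance G) \<le> enat (card (odd_components H))" using F by simp
qed

section \<open>Colorings of the 4-pole\<close>

lemma petersen_simps:
  "verts petersen = {0, 1, 2, 3, 4, 5, 6, 7, 8, 9}"
  "edges petersen = {{5, 7}, {6, 8}, {7, 9}, {8, 5}, {9, 6}, {0, 5}, {1, 6}, {2, 7}, {3, 8}, {4, 9},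
     {0, 1}, {1, 2}, {2, 3}, {3, 4}, {4, 0}}"
  "ends petersen e = e"
proof -
  have l5: "{..<5} = {0, 1, 2, 3, 4::nat}" by (auto simp: lessThan_nat_numeral)
  show "verts petersen = {0, 1, 2, 3, 4, 5, 6, 7, 8, 9}"
    by (auto simp: petersen_def lessThan_nat_numeral)
  have "edges petersen = (\<lambda>i. {i, Suc i mod 5}) ` {..<5} \<union> (\<lambda>i. {i, i + 5}) ` {..<5} \<union>
      (\<lambda>i. {i + 5, (i + 2) mod 5 + 5}) ` {..<5}"
    by (auto simp: petersen_def)
  then show "edges petersen = {{5, 7}, {6, 8}, {7, 9}, {8, 5}, {9, 6}, {0, 5}, {1, 6}, {2, 7}, {3, 8},
     {4, 9}, {0, 1}, {1, 2}, {2, 3}, {3, 4}, {4, 0}}"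
    unfolding l5 by (simp add: numeral_2_eq_2)
  show "ends petersen e = e" by (simp add: petersen_def)
qed

lemma pole_B_simps:
  "verts pole_B = {1, 2, 3, 4, 6, 7, 8, 9}"
  "edges pole_B = {{1, 2}, {2, 3}, {3, 4}, {1, 6}, {2, 7}, {3, 8}, {4, 9}, {6, 8}, {7, 9}, {6, 9}}"
  "ends pole_B e = e"
proof -
  show "verts pole_B = {1, 2, 3, 4, 6, 7, 8, 9}"
    by (auto simp: pole_B_def sever_def petersen_simps)
  have "edges pole_B = edges petersen \<inter> {e. e \<inter> {0, 5} = {}}"
    by (auto simp: pole_B_def sever_def petersen_simps(3))
  then show "edges pole_B = {{1, 2}, {2, 3}, {3, 4}, {1, 6}, {2, 7}, {3, 8}, {4, 9}, {6, 8}, {7, 9}, {6, 9}}"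
    by (simp add: petersen_simps(2) Int_insert_left insert_commute)
  show "ends pole_B e = e" by (simp add: pole_B_def sever_def petersen_simps)
qed

lemma copy_foot_simps:
  "copy_foot j i semi_a1 = InCopy j i 1" "copy_foot j i semi_a2 = InCopy j i 4"
  "copy_foot j i semi_b1 = InCopy j i 7" "copy_foot j i semi_b2 = InCopy j i 8"
proof -
  have "foot pole_B s = the_elem (s - {0, 5})" for s
    by (simp add: pole_B_def sever_def petersen_simps)
  moreover have "{0, Suc 0} - {0, 5} = {1::nat}" "{0, 4} - {0, 5} = {4::nat}"
    "{5, 7} - {0, 5} = {7::nat}" "{5, 8} - {0, 5} = {8::nat}" by auto
  ultimately show "copy_foot j i semi_a1 = InCopy j i 1" "copy_foot j i semi_a2 = InCopy j i 4"
    "copy_foot j i semi_b1 = InCopy j i 7" "copy_foot j i semi_b2 = InCopy j i 8"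
    by (simp_all add: copy_foot_def semi_a1_def semi_a2_def semi_b1_def semi_b2_def)
qed

lemma copy_edges_eq:
  "copy_edges j i = {{InCopy j i 1, InCopy j i 2}, {InCopy j i 2, InCopy j i 3},
     {InCopy j i 3, InCopy j i 4}, {InCopy j i 1, InCopy j i 6}, {InCopy j i 2, InCopy j i 7},
     {InCopy j i 3, InCopy j i 8}, {InCopy j i 4, InCopy j i 9}, {InCopy j i 6, InCopy j i 8},
     {InCopy j i 7, InCopy j i 9}, {InCopy j i 6, InCopy j i 9}}"
  by (simp add: copy_edges_def pole_B_simps)

lemma copy_verts_eq: "copy_verts j i = InCopy j i ` {1, 2, 3, 4, 6, 7, 8, 9}"
  by (simp add: copy_verts_def pole_B_simps)

section \<open>Missing colors at the feet of the 4-pole\<close>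

lemma third_color:
  fixes a b d x :: nat
  assumes "a < 3" "b < 3" "d < 3" "a \<noteq> b" "a \<noteq> d" "b \<noteq> d" "x < 3"
  shows "x = a \<or> x = b \<or> x = d"
proof -
  have "{a, b, d} = {..<3}" using assms by (intro card_subset_eq) auto
  then show ?thesis using \<open>x < 3\<close> by blast
qed

text \<open>Here \<open>x\<close> and \<open>y\<close> stand for the colors missing at two feet: 1
  and 4 for the \<open>a\<close> semiedges, 7 and 8 for the \<open>b\<close> semiedges. The two
  claims are independent of each other, so either one applies when the opposite semiedges have been
  deleted.\<close>

lemma B_semiedge_colors:
  fixes c12 c23 c34 c16 c27 c38 c49 c68 c79 c69 :: nat
  assumes lt: "c12 < 3" "c23 < 3" "c34 < 3" "c16 < 3" "c27 < 3" "c38 < 3" "c49 < 3" "c68 < 3"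
    "c79 < 3" "c69 < 3"
    and neq: "c12 \<noteq> c16" "c12 \<noteq> c23" "c12 \<noteq> c27" "c23 \<noteq> c27" "c23 \<noteq> c34" "c23 \<noteq> c38" "c34 \<noteq> c38"
    "c34 \<noteq> c49" "c16 \<noteq> c68" "c16 \<noteq> c69" "c68 \<noteq> c69" "c27 \<noteq> c79" "c38 \<noteq> c68"
    "c49 \<noteq> c79" "c49 \<noteq> c69" "c79 \<noteq> c69"
  shows "\<lbrakk>x < 3; y < 3; x \<noteq> c12; x \<noteq> c16; y \<noteq> c34; y \<noteq> c49\<rbrakk> \<Longrightarrow> x = y"
    and "\<lbrakk>x < 3; y < 3; x \<noteq> c27; x \<noteq> c79; y \<noteq> c38; y \<noteq> c68\<rbrakk> \<Longrightarrow> x = y"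
proof -
  \<comment> \<open>The three edges at vertex 6 carry all three colors and serve as names for
    them.\<close>
  note val = third_color[of c16 c68 c69, OF lt(4,8,10) neq(9-11)]
  have v79: "c79 = c16 \<or> c79 = c68" and v49: "c49 = c16 \<or> c49 = c68"
    using val[OF lt(9)] val[OF lt(7)] neq by auto
  have 38: "c38 = c16 \<or> c38 = c69" using val[OF lt(6)] neq by auto
  \<comment> \<open>Otherwise 34 and 38 carry the colors of 16 and 69 in some order. This forces the
    color of 68 on 23 and that of 69 on 27, and no color remains for 12.\<close>
  have "c79 \<noteq> c16"
  proof
    assume 79: "c79 = c16"
    then have 49: "c49 = c68" using v49 neq by auto
    have "c34 = c16 \<or> c34 = c69" using val[OF lt(3)] neq 49 by auto
    with 38 have 23: "c23 = c68" using val[OF lt(2)] neq by auto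
    then have "c27 = c69" using val[OF lt(5)] neq 79 by auto
    then show False using val[OF lt(1)] neq 23 by auto
  qed
  then have 79: "c79 = c68" and 49: "c49 = c16" using v79 v49 neq by auto
  have 34: "c34 = c68 \<or> c34 = c69" using val[OF lt(3)] neq 49 by auto
  have v12: "c12 = c68 \<or> c12 = c69" using val[OF lt(1)] neq by auto
  have v27: "c27 = c16 \<or> c27 = c69" using val[OF lt(5)] neq 79 by auto
  \<comment> \<open>As 16 and 49 have the same color, vertices 1 and 4 miss the same color once 12
    and 34 agree.\<close>
  have 12: "c12 = c34"
  proof (rule ccontr)
    assume "c12 \<noteq> c34"
    then have 23: "c23 = c16" using 34 v12 val[OF lt(2)] neq by auto
    then have "c27 = c69" "c38 = c69" using v27 38 neq by auto
    then show False using \<open>c12 \<noteq> c34\<close> 34 v12 neq by auto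
  qed
  \<comment> \<open>Likewise 79 and 68 have the same color, so this equates the colors missing at 7
    and 8.\<close>
  have 27: "c27 = c38"
  proof (rule ccontr)
    assume "c27 \<noteq> c38"
    then have 23: "c23 = c68" using 38 v27 val[OF lt(2)] neq by auto
    then have "c12 = c69" "c34 = c69" using 34 v12 neq by auto
    then show False using \<open>c27 \<noteq> c38\<close> 38 v27 neq by auto
  qed
  show "\<lbrakk>x < 3; y < 3; x \<noteq> c12; x \<noteq> c16; y \<noteq> c34; y \<noteq> c49\<rbrakk> \<Longrightarrow> x = y"
    using third_color[of c12 c16 x y] 12 49 lt neq by blast
  show "\<lbrakk>x < 3; y < 3; x \<noteq> c27; x \<noteq> c79; y \<noteq> c38; y \<noteq> c68\<rbrakk> \<Longrightarrow> x = y"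
    using third_color[of c27 c79 x y] 27 79 lt neq by blast
qed

text \<open>Carries the result on missing colors over to a copy inside a larger graph. Only the
  inner edges of the copy and the two edges being compared must be present, so it can be used after
  deletions.\<close>

lemma copy_semiedge_colors:
  assumes c: "edge_coloring 3 H c" and H: "ends H = blow_ends G"
    and copy: "Added ` copy_edges j i \<subseteq> edges H"
    and x: "x \<in> edges H - Added ` copy_edges j i" and y: "y \<in> edges H - Added ` copy_edges j i"
  shows "\<lbrakk>InCopy j i 1 \<in> blow_ends G x; InCopy j i 4 \<in> blow_ends G y\<rbrakk> \<Longrightarrow> c x = c y"
    and "\<lbrakk>InCopy j i 7 \<in> blow_ends G x; InCopy j i 8 \<in> blow_ends G y\<rbrakk> \<Longrightarrow> c x = c y"
proof -
  define d where "d p q = c (Added {InCopy j i p, InCopy j i q})" for p q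
  have lt: "c e < 3" if "e \<in> edges H" for e using c that by (simp add: edge_coloring_def)
  have neq: "c e \<noteq> c f" if "e \<in> edges H" "f \<in> edges H" "e \<noteq> f" "w \<in> blow_ends G e"
    "w \<in> blow_ends G f" for e f w
    using c that H by (auto simp: edge_coloring_def)
  have E: "Added {InCopy j i p, InCopy j i q} \<in> edges H"
    if "{InCopy j i p, InCopy j i q :: 'a blow_vert} \<in> copy_edges j i" for p q
    using that copy by blast
  have d_lt: "d p q < 3" if "{InCopy j i p, InCopy j i q :: 'a blow_vert} \<in> copy_edges j i" for p q
    unfolding d_def using that by (intro lt E)
  have d_neq: "d p q \<noteq> d r s" if "{InCopy j i p, InCopy j i q :: 'a blow_vert} \<in> copy_edges j i"
    "{InCopy j i r, InCopy j i s :: 'a blow_vert} \<in> copy_edges j i" "{p, q} \<noteq> {r, s}" "{p, q} \<inter> {r, s} \<noteq> {}"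
    for p q r s
  proof -
    have ne: "Added {InCopy j i p, InCopy j i q} \<noteq> Added {InCopy j i r, InCopy j i s}"
      using that(3) by (auto simp: doubleton_eq_iff)
    from that(4) obtain t where t: "t = p \<or> t = q" "t = r \<or> t = s" by blast
    show ?thesis unfolding d_def
      by (rule neq[OF E[OF that(1)] E[OF that(2)] ne, of "InCopy j i t"])
        (use t in \<open>auto simp: blow_ends_def\<close>)
  qed
  have semi: "c z \<noteq> d p q" if "z \<in> edges H - Added ` copy_edges j i"
    "{InCopy j i p, InCopy j i q :: 'a blow_vert} \<in> copy_edges j i"
    "InCopy j i p \<in> blow_ends G z \<or> InCopy j i q \<in> blow_ends G z" for z p q
  proof -
    have ne: "z \<noteq> Added {InCopy j i p, InCopy j i q}" using that(1,2) by blast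
    from that(3) obtain t where t: "t = p \<or> t = q" "InCopy j i t \<in> blow_ends G z" by blast
    show ?thesis unfolding d_def
      by (rule neq[OF _ E[OF that(2)] ne t(2)]) (use t that(1) in \<open>auto simp: blow_ends_def\<close>)
  qed
  note xd = semi[OF x] and yd = semi[OF y]
  have lts:
    "d 1 2 < 3" "d 2 3 < 3" "d 3 4 < 3" "d 1 6 < 3" "d 2 7 < 3" "d 3 8 < 3" "d 4 9 < 3"
    "d 6 8 < 3" "d 7 9 < 3" "d 6 9 < 3"
    by (rule d_lt; simp add: copy_edges_eq doubleton_eq_iff)+
  have neqs:
    "d 1 2 \<noteq> d 1 6" "d 1 2 \<noteq> d 2 3" "d 1 2 \<noteq> d 2 7" "d 2 3 \<noteq> d 2 7"
    "d 2 3 \<noteq> d 3 4" "d 2 3 \<noteq> d 3 8" "d 3 4 \<noteq> d 3 8" "d 3 4 \<noteq> d 4 9"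
    "d 1 6 \<noteq> d 6 8" "d 1 6 \<noteq> d 6 9" "d 6 8 \<noteq> d 6 9" "d 2 7 \<noteq> d 7 9"
    "d 3 8 \<noteq> d 6 8" "d 4 9 \<noteq> d 7 9" "d 4 9 \<noteq> d 6 9" "d 7 9 \<noteq> d 6 9"
    by (rule d_neq; simp add: copy_edges_eq doubleton_eq_iff)+
  have clt: "c x < 3" "c y < 3" using lt x y by auto
  show "c x = c y" if "InCopy j i 1 \<in> blow_ends G x" "InCopy j i 4 \<in> blow_ends G y"
  proof (rule B_semiedge_colors(1)[OF lts neqs clt])
    show "c x \<noteq> d 1 2" "c x \<noteq> d 1 6"
      by (rule xd; use that(1) in \<open>simp add: copy_edges_eq doubleton_eq_iff\<close>)+
    show "c y \<noteq> d 3 4" "c y \<noteq> d 4 9"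
      by (rule yd; use that(2) in \<open>simp add: copy_edges_eq doubleton_eq_iff\<close>)+
  qed
  show "c x = c y" if "InCopy j i 7 \<in> blow_ends G x" "InCopy j i 8 \<in> blow_ends G y"
  proof (rule B_semiedge_colors(2)[OF lts neqs clt])
    show "c x \<noteq> d 2 7" "c x \<noteq> d 7 9"
      by (rule xd; use that(1) in \<open>simp add: copy_edges_eq doubleton_eq_iff\<close>)+
    show "c y \<noteq> d 3 8" "c y \<noteq> d 6 8"
      by (rule yd; use that(2) in \<open>simp add: copy_edges_eq doubleton_eq_iff\<close>)+
  qed
qed

section \<open>Counting the deleted edges zone by zone\<close>

text \<open>
  A deleted edge in \<open>Cp (j, i)\<close> accounts for at most two of the hit zones, any other one for at
  most one; this gives the factor one half.
\<close>

lemma zone_count: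
  fixes Cp Lk :: "nat \<times> nat \<Rightarrow> 'x set"
  assumes F: "finite F"
    and disj: "disjoint_family_on (case_sum Cp Lk) (positions Ds <+> positions Ds)"
    and hit: "\<And>j i. (j, i) \<in> positions Ds \<Longrightarrow>
      F \<inter> (Cp (j, i) \<union> Cp (j, next_pos Ds j i) \<union> Lk (j, i)) \<noteq> {}"
  shows "(\<Sum>j<length Ds. \<lceil>real (length (Ds ! j)) / 2\<rceil>) \<le> int (card F)"
proof -
  have pos: "positions Ds = Sigma {..<length Ds} (\<lambda>j. {..<length (Ds ! j)})"
    by (auto simp: positions_def)
  define A where "A j = {i. i < length (Ds ! j) \<and> F \<inter> Cp (j, i) \<noteq> {}}" for j
  define L where "L j = {i. i < length (Ds ! j) \<and> F \<inter> Lk (j, i) \<noteq> {}}" for j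
  have fin: "finite (A j)" "finite (L j)" for j by (auto simp: A_def L_def)
  have cycle: "\<lceil>real (length (Ds ! j)) / 2\<rceil> \<le> int (card (A j) + card (L j))" if "j < length Ds" for j
  proof -
    define k where "k = length (Ds ! j)"
    \<comment> \<open>The zones whose second copy is hit. The cyclic shift is injective, so there
      are at most as many of them as hit copies; each hit copy is thus counted for its two
      zones.\<close>
    define N where "N = {i. i < k \<and> Suc i mod k \<in> A j}"
    have "inj_on (\<lambda>i. Suc i mod k) {..<k}"
      by (rule inj_onI) (auto simp: mod_Suc split: if_splits)
    then have "inj_on (\<lambda>i. Suc i mod k) N" by (rule inj_on_subset) (auto simp: N_def)
    then have N: "card N \<le> card (A j)"
      by (rule card_inj_on_le) (auto simp: N_def fin)
    have "{..<k} \<subseteq> A j \<union> N \<union> L j"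
    proof
      fix i assume "i \<in> {..<k}"
      moreover from this have "Suc i mod k < k" by auto
      ultimately show "i \<in> A j \<union> N \<union> L j"
        using hit[of j i] that by (auto simp: A_def L_def N_def k_def positions_def next_pos_def)
    qed
    then have "k \<le> card (A j \<union> N \<union> L j)"
      using card_mono[of "A j \<union> N \<union> L j" "{..<k}"] fin by (simp add: N_def)
    also have "\<dots> \<le> card (A j) + card N + card (L j)"
      by (meson add_le_mono card_Un_le le_refl le_trans)
    finally have "k \<le> 2 * (card (A j) + card (L j))" using N by simp
    \<comment> \<open>The number of hit copies and link sets is an integer, so half of
      \<open>k\<close> may be rounded up here, separately for every cycle.\<close>
    then have "real k / 2 \<le> real_of_int (int (card (A j) + card (L j)))" by simp
    then show ?thesis unfolding k_def by (rule ceiling_le)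
  qed
  \<comment> \<open>All hit sets of all cycles, with copies and link sets kept apart by the disjoint
    sum. They are pairwise disjoint and each contains an edge of \<open>F\<close>, so their number
    is at most \<open>card F\<close>.\<close>
  define I where "I = Sigma {..<length Ds} A <+> Sigma {..<length Ds} L"
  have I: "I \<subseteq> positions Ds <+> positions Ds"
    by (auto simp: I_def A_def L_def pos)
  have finI: "finite I" using fin by (simp add: I_def)
  have "(\<Sum>j<length Ds. card (A j) + card (L j)) = card I"
    using fin by (simp add: I_def card_Plus card_SigmaI sum.distrib)
  also have "\<dots> \<le> (\<Sum>t\<in>I. card (F \<inter> case_sum Cp Lk t))"
  proof -
    have "1 \<le> card (F \<inter> case_sum Cp Lk t)" if "t \<in> I" for t
      using that F by (auto simp: I_def A_def L_def Suc_le_eq card_gt_0_iff)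
    then show ?thesis using sum_mono[of I "\<lambda>_. 1" "\<lambda>t. card (F \<inter> case_sum Cp Lk t)"] by simp
  qed
  also have "\<dots> = card (\<Union>t\<in>I. F \<inter> case_sum Cp Lk t)"
  proof (rule card_UN_disjoint[symmetric])
    show "\<forall>s\<in>I. \<forall>t\<in>I. s \<noteq> t \<longrightarrow> F \<inter> case_sum Cp Lk s \<inter> (F \<inter> case_sum Cp Lk t) = {}"
      using disj I unfolding disjoint_family_on_def by blast
  qed (use F finI in auto)
  also have "\<dots> \<le> card F" using F by (intro card_mono) auto
  finally have le: "(\<Sum>j<length Ds. card (A j) + card (L j)) \<le> card F" .
  have "(\<Sum>j<length Ds. \<lceil>real (length (Ds ! j)) / 2\<rceil>) \<le> (\<Sum>j<length Ds. int (card (A j) + card (L j)))"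
    using cycle by (intro sum_mono) auto
  also have "\<dots> = int (\<Sum>j<length Ds. card (A j) + card (L j))" by simp
  also have "\<dots> \<le> int (card F)" using le by linarith
  finally show ?thesis .
qed

section \<open>The blown-up graphs\<close>

definition prev_pos :: "('v, 'e) cyc list \<Rightarrow> nat \<Rightarrow> nat \<Rightarrow> nat" where
  "prev_pos Ds j i = (if i = 0 then length (Ds ! j) - 1 else i - 1)"

lemma next_pos_eq_iff:
  assumes "i < length (Ds ! j)" "i' < length (Ds ! j)"
  shows "next_pos Ds j i' = i \<longleftrightarrow> i' = prev_pos Ds j i"
  using assms by (auto simp: next_pos_def prev_pos_def mod_Suc)

text \<open>
  The links \<open>i\<close> are all edges between the copies \<open>i\<close> and \<open>i + 1\<close>; some of them are added at position
  \<open>i + 1\<close> in the definitions of the two graphs.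
\<close>

definition semi_links :: "('v, 'e) cyc list \<Rightarrow> nat \<Rightarrow> nat \<Rightarrow> 'v blow_vert set set" where
  "semi_links Ds j i =
     {{vert_at Ds j (next_pos Ds j i), InCopy j (next_pos Ds j i) 7},
      {InCopy j i 4, InCopy j (next_pos Ds j i) 8},
      {InCopy j i 1, vert_at Ds j (next_pos Ds j i)}}"

definition full_links :: "('v, 'e) cyc list \<Rightarrow> nat \<Rightarrow> nat \<Rightarrow> 'v blow_vert set set" where
  "full_links Ds j i =
     {{vert_at Ds j (next_pos Ds j i), NewU j (next_pos Ds j i)},
      {vert_at Ds j (next_pos Ds j i), NewW j (next_pos Ds j i)},
      {NewU j (next_pos Ds j i), InCopy j (next_pos Ds j i) 7},
      {NewW j (next_pos Ds j i), InCopy j (next_pos Ds j i) 8},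
      {InCopy j i 1, NewU j (next_pos Ds j i)},
      {InCopy j i 4, NewW j (next_pos Ds j i)}}"

lemma copy_edges_subset: "X \<in> copy_edges j i \<Longrightarrow> X \<subseteq> range (InCopy j i)"
  by (auto simp: copy_edges_def)

lemma copy_edges_nonempty: "X \<in> copy_edges j i \<Longrightarrow> X \<noteq> {}"
  by (auto simp: copy_edges_eq)

lemma copy_edges_card: "X \<in> copy_edges j i \<Longrightarrow> card X = 2"
  by (auto simp: copy_edges_eq)

lemma copy_edges_disjoint:
  assumes "X \<in> copy_edges j i" "X \<in> copy_edges j' i'"
  shows "j = j' \<and> i = i'"
  using copy_edges_subset[OF assms(1)] copy_edges_subset[OF assms(2)] copy_edges_nonempty[OF assms(1)]
  by blast

lemma not_in_copy_edges:
  "X \<in> copy_edges j i \<Longrightarrow> Old v \<notin> X" "X \<in> copy_edges j i \<Longrightarrow> NewU j' i' \<notin> X"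
  "X \<in> copy_edges j i \<Longrightarrow> NewW j' i' \<notin> X"
  using copy_edges_subset by blast+

lemma edge_coloringD:
  assumes "edge_coloring k G c" "w \<in> ends G e" "w \<in> ends G f" "e \<in> edges G" "f \<in> edges G" "e \<noteq> f"
  shows "c e \<noteq> c f"
  using assms by (auto simp: edge_coloring_def)

lemma degree_le_3I:
  assumes "incident G v \<subseteq> {a, b, c}"
  shows "degree G v \<le> 3"
proof -
  have "card (incident G v) \<le> card {a, b, c}" using assms by (intro card_mono) auto
  also have "\<dots> \<le> 3" by (simp add: card_insert_if)
  finally show ?thesis by (simp add: degree_def incident_def)
qed

text \<open>The exceptional vertices are the feet of the four semiedges; each of them can take one
  link.\<close>

lemma pole_B_degree:
  assumes "p \<in> verts pole_B"
  shows "card {q. {p, q} \<in> edges pole_B} = (if p \<in> {1, 4, 7, 8} then 2 else 3)"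
  using assms unfolding pole_B_simps(1) insert_iff empty_iff
  by (elim disjE FalseE; simp add: pole_B_simps(2) doubleton_eq_iff Collect_disj_eq)

lemma finite_pole_B_neighbours: "finite {q. {p, q} \<in> edges pole_B}"
proof (rule finite_subset)
  show "{q. {p, q} \<in> edges pole_B} \<subseteq> \<Union>(edges pole_B)" by blast
  show "finite (\<Union>(edges pole_B))" by (simp add: pole_B_simps)
qed

lemma copy_edges_at:
  assumes "X \<in> copy_edges j i" "InCopy j i p \<in> X"
  obtains q where "{p, q} \<in> edges pole_B" "X = {InCopy j i p, InCopy j i q}"
proof -
  obtain e where e: "e \<in> edges pole_B" "X = InCopy j i ` e"
    using assms(1) by (auto simp: copy_edges_def pole_B_simps(3))
  then have "p \<in> e" "card e = 2" using assms(2) by (auto simp: pole_B_simps(2))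
  then obtain q where "e = {p, q}" by (auto simp: card_2_iff doubleton_eq_iff)
  then show ?thesis using e that by auto
qed

section \<open>The cycles of D inside the cubic graph\<close>

locale blowup_data =
  fixes G D :: "('v, 'e) multigraph" and Ds :: "('v, 'e) cyc list"
  assumes graph: "is_graph G" and cubic: "cubic G" and sub: "subgraph D G" and reg: "regular 2 D"
    and cyc: "cycles_of D Ds"
begin

lemma length_ge_2: "j < length Ds \<Longrightarrow> 2 \<le> length (Ds ! j)"
  using cyc by (auto simp: cycles_of_def is_cycle_def)

lemma cyc_edges_eq: "(\<Union>C\<in>set Ds. cyc_edges C) = edges D"
  using cyc by (simp add: cycles_of_def)

text \<open>Different cycles have disjoint vertex sets and no cycle repeats a vertex.\<close>

lemma vert_at_eq_iff:
  assumes "(j, i) \<in> positions Ds" "(j', i') \<in> positions Ds"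
  shows "vert_at Ds j i = vert_at Ds j' i' \<longleftrightarrow> j = j' \<and> i = i'"
proof
  assume eq: "vert_at Ds j i = vert_at Ds j' i'"
  have "fst (Ds ! j ! i) \<in> cyc_verts (Ds ! j)" "fst (Ds ! j' ! i') \<in> cyc_verts (Ds ! j')"
    using assms by (auto simp: positions_def cyc_verts_def)
  then have "j = j'" using eq cyc assms by (auto simp: cycles_of_def positions_def vert_at_def)
  moreover have "distinct (map fst (Ds ! j))"
    using cyc assms by (auto simp: cycles_of_def is_cycle_def positions_def)
  ultimately show "j = j' \<and> i = i'"
    using eq assms by (auto simp: positions_def vert_at_def distinct_conv_nth)
qed simp

lemma next_pos_in: "(j, i) \<in> positions Ds \<Longrightarrow> (j, next_pos Ds j i) \<in> positions Ds"
  by (auto simp: positions_def next_pos_def intro!: mod_less_divisor)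

lemma next_pos_inj:
  assumes "(j, i) \<in> positions Ds" "(j, i') \<in> positions Ds"
  shows "next_pos Ds j i = next_pos Ds j i' \<longleftrightarrow> i = i'"
proof -
  have "i < length (Ds ! j)" "i' < length (Ds ! j)" "next_pos Ds j i' < length (Ds ! j)"
    using assms next_pos_in[OF assms(2)] by (auto simp: positions_def)
  then show ?thesis using next_pos_eq_iff[of "next_pos Ds j i'" Ds j] by metis
qed

lemma next_pos_neq: "(j, i) \<in> positions Ds \<Longrightarrow> next_pos Ds j i \<noteq> i"
  using length_ge_2[of j] by (auto simp: positions_def next_pos_def mod_Suc)

lemma finite_positions: "finite (positions Ds)"
proof -
  have "positions Ds = Sigma {..<length Ds} (\<lambda>j. {..<length (Ds ! j)})"
    by (auto simp: positions_def)
  then show ?thesis by simp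
qed

lemma vert_at_in: "(j, i) \<in> positions Ds \<Longrightarrow> fst (Ds ! j ! i) \<in> verts D"
  using cyc by (auto simp: positions_def cycles_of_def cyc_verts_def intro: nth_mem bexI[of _ "Ds ! j"])

lemma vert_at_in_G: "(j, i) \<in> positions Ds \<Longrightarrow> fst (Ds ! j ! i) \<in> verts G"
  using vert_at_in sub by (auto simp: subgraph_def)

lemma kept_at:
  assumes "v \<in> verts D"
  obtains e where "{e \<in> edges G - edges D. v \<in> ends G e} = {e}"
proof -
  have v: "v \<in> verts G" using assms sub by (auto simp: subgraph_def)
  have "incident D v = {e \<in> edges D. v \<in> ends G e}" using sub by (auto simp: subgraph_def incident_def)
  then have eq: "{e \<in> edges G - edges D. v \<in> ends G e} = incident G v - incident D v"
    by (auto simp: incident_def)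
  have "card (incident D v) = 2" "card (incident G v) = 3"
    using assms v reg cubic by (simp_all add: regular_def degree_def incident_def)
  moreover have "incident D v \<subseteq> incident G v" using sub by (auto simp: subgraph_def incident_def)
  ultimately have "card (incident G v - incident D v) = 1"
    using card_Diff_subset[of "incident D v" "incident G v"] finite_incident[of D v] sub
    by (simp add: subgraph_def)
  then show ?thesis using that eq by (auto simp: card_1_singleton_iff)
qed

lemma card_cyc_verts: "j < length Ds \<Longrightarrow> card (cyc_verts (Ds ! j)) = length (Ds ! j)"
  using cyc distinct_card[of "map fst (Ds ! j)"]
  by (auto simp: cycles_of_def is_cycle_def cyc_verts_def)

text \<open>Common to both constructions, which differ only in their links \<open>Lk\<close>. The
  first two assumptions make copies and link sets pairwise disjoint; the third says that a deletion
  leaving a colorable graph hits every zone.\<close>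

lemma resistance_ge:
  fixes H :: "('v blow_vert, ('v, 'e) blow_edge) multigraph"
  assumes H: "is_graph H"
    and disj: "\<And>j i j' i' X. \<lbrakk>(j, i) \<in> positions Ds; (j', i') \<in> positions Ds; X \<in> Lk j i; X \<in> Lk j' i'\<rbrakk>
      \<Longrightarrow> j = j' \<and> i = i'"
    and link: "\<And>j i j' i' X. \<lbrakk>(j, i) \<in> positions Ds; X \<in> Lk j i\<rbrakk> \<Longrightarrow> X \<notin> copy_edges j' i'"
    and zone: "\<And>F c j i. \<lbrakk>edge_coloring 3 (delete_edges H F) c; (j, i) \<in> positions Ds\<rbrakk>
      \<Longrightarrow> F \<inter> Added ` (copy_edges j i \<union> copy_edges j (next_pos Ds j i) \<union> Lk j i) \<noteq> {}"
  shows "(\<Sum>i<length Ds. \<lceil>real (card (cyc_verts (Ds ! i))) / 2\<rceil>) \<le> int (resistance H)"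
proof -
  \<comment> \<open>Deleting everything leaves a colorable graph, so the minimum defining the
    resistance is attained by some \<open>F\<close>.\<close>
  have "edge_colorable 3 (delete_edges H (edges H))" by (simp add: edge_colorable_def)
  then have "\<exists>n. \<exists>F\<subseteq>edges H. card F = n \<and> edge_colorable 3 (delete_edges H F)" by blast
  then have "\<exists>F\<subseteq>edges H. card F = resistance H \<and> edge_colorable 3 (delete_edges H F)"
    unfolding resistance_def by (rule LeastI_ex)
  then obtain F c where F: "F \<subseteq> edges H" "card F = resistance H"
    and c: "edge_coloring 3 (delete_edges H F) c"
    by (auto simp: edge_colorable_iff)
  define Cp where "Cp = (\<lambda>(j, i). Added ` copy_edges j i :: ('v, 'e) blow_edge set)"
  define L where "L = (\<lambda>(j, i). Added ` Lk j i :: ('v, 'e) blow_edge set)"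
  have "(\<Sum>j<length Ds. \<lceil>real (length (Ds ! j)) / 2\<rceil>) \<le> int (card F)"
  proof (rule zone_count[of F Cp L])
    show "finite F" using F H by (auto simp: is_graph_def intro: finite_subset)
    show "disjoint_family_on (case_sum Cp L) (positions Ds <+> positions Ds)"
      unfolding disjoint_family_on_def
    proof (intro ballI impI)
      fix s t assume "s \<in> positions Ds <+> positions Ds" "t \<in> positions Ds <+> positions Ds" "s \<noteq> t"
      then show "case_sum Cp L s \<inter> case_sum Cp L t = {}"
        by (cases s; cases t) (auto simp: Cp_def L_def dest: disj link copy_edges_disjoint)
    qed
    show "F \<inter> (Cp (j, i) \<union> Cp (j, next_pos Ds j i) \<union> L (j, i)) \<noteq> {}" if "(j, i) \<in> positions Ds" for j i
      using zone[OF c that] by (auto simp: Cp_def L_def)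
  qed
  then show ?thesis using F card_cyc_verts by simp
qed

lemma verts_D_E:
  assumes "v \<in> verts D"
  obtains j i where "(j, i) \<in> positions Ds" "Old v = vert_at Ds j i"
proof -
  obtain C where "C \<in> set Ds" "v \<in> cyc_verts C" using assms cyc by (auto simp: cycles_of_def)
  then obtain j i where "j < length Ds" "C = Ds ! j" "i < length C" "v = fst (C ! i)"
    by (auto simp: cyc_verts_def in_set_conv_nth)
  then show ?thesis using that by (auto simp: positions_def vert_at_def)
qed

lemma vert_at_next_iff:
  assumes "(j, i) \<in> positions Ds" "(j', i') \<in> positions Ds"
  shows "vert_at Ds j' (next_pos Ds j' i') = vert_at Ds j i \<longleftrightarrow> j' = j \<and> i' = prev_pos Ds j i"
  using vert_at_eq_iff[OF next_pos_in[OF assms(2)] assms(1)] next_pos_eq_iff assms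
  by (auto simp: positions_def)

section \<open>The blown-up graphs are loopless multigraphs\<close>

lemma SemiBlowup_simps:
  "verts (SemiBlowup G Ds) = Old ` verts G \<union> (\<Union>(j, i)\<in>positions Ds. copy_verts j i)"
  "edges (SemiBlowup G Ds) = Kept ` (edges G - edges D) \<union>
     Added ` (\<Union>(j, i)\<in>positions Ds. copy_edges j i \<union>
       {{vert_at Ds j i, InCopy j i 7}, {InCopy j i 4, InCopy j (next_pos Ds j i) 8},
        {InCopy j i 1, vert_at Ds j (next_pos Ds j i)}})"
  "ends (SemiBlowup G Ds) = blow_ends G"
  by (simp_all add: SemiBlowup_def cyc_edges_eq copy_foot_simps)

lemma Blowup_simps:
  "verts (Blowup G Ds) = Old ` verts G \<union>
     (\<Union>(j, i)\<in>positions Ds. copy_verts j i \<union> {NewU j i, NewW j i})"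
  "edges (Blowup G Ds) = Kept ` (edges G - edges D) \<union>
     Added ` (\<Union>(j, i)\<in>positions Ds. copy_edges j i \<union>
       {{vert_at Ds j i, NewU j i}, {vert_at Ds j i, NewW j i},
        {NewU j i, InCopy j i 7}, {NewW j i, InCopy j i 8},
        {InCopy j i 1, NewU j (next_pos Ds j i)}, {InCopy j i 4, NewW j (next_pos Ds j i)}})"
  "ends (Blowup G Ds) = blow_ends G"
  by (simp_all add: Blowup_def cyc_edges_eq copy_foot_simps)

lemma kept_ends:
  assumes "e \<in> edges G"
  shows "blow_ends G (Kept e) \<subseteq> Old ` verts G" "card (blow_ends G (Kept e)) = 2"
  using assms graph card_image[of Old "ends G e"] by (auto simp: blow_ends_def is_graph_def inj_on_def)

lemma copy_edges_verts: "X \<in> copy_edges j i \<Longrightarrow> X \<subseteq> copy_verts j i"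
  by (auto simp: copy_edges_eq copy_verts_eq)

lemma vert_at_verts: "(j, i) \<in> positions Ds \<Longrightarrow> vert_at Ds j i \<in> Old ` verts G"
  using vert_at_in_G by (auto simp: vert_at_def)

lemma vert_at_simps [simp]:
  "vert_at Ds j i \<noteq> InCopy j' i' p" "InCopy j' i' p \<noteq> vert_at Ds j i"
  "vert_at Ds j i \<noteq> NewU j' i'" "NewU j' i' \<noteq> vert_at Ds j i"
  "vert_at Ds j i \<noteq> NewW j' i'" "NewW j' i' \<noteq> vert_at Ds j i"
  by (auto simp: vert_at_def)

lemma is_graph_SemiBlowup: "is_graph (SemiBlowup G Ds)"
  unfolding is_graph_def
proof (intro conjI ballI)
  show "finite (verts (SemiBlowup G Ds))" "finite (edges (SemiBlowup G Ds))"
    using finite_positions graph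
    by (auto simp: SemiBlowup_simps is_graph_def copy_verts_eq copy_edges_eq)
next
  fix x assume "x \<in> edges (SemiBlowup G Ds)"
  then consider (kept) e where "x = Kept e" "e \<in> edges G"
    | (copy) j i X where "x = Added X" "(j, i) \<in> positions Ds" "X \<in> copy_edges j i"
    | (link) j i X where "x = Added X" "(j, i) \<in> positions Ds"
      "X \<in> {{vert_at Ds j i, InCopy j i 7}, {InCopy j i 4, InCopy j (next_pos Ds j i) 8},
        {InCopy j i 1, vert_at Ds j (next_pos Ds j i)}}"
    unfolding SemiBlowup_simps by blast
  then have "ends (SemiBlowup G Ds) x \<subseteq> verts (SemiBlowup G Ds) \<and> card (ends (SemiBlowup G Ds) x) = 2"
  proof cases
    case kept
    then show ?thesis using kept_ends[of e] by (auto simp: SemiBlowup_simps)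
  next
    case copy
    then show ?thesis using copy_edges_verts[of X j i] copy_edges_card[of X j i]
      by (auto simp: SemiBlowup_simps blow_ends_def)
  next
    case link
    have "{InCopy j i 1, InCopy j i 4, InCopy j i 7, InCopy j (next_pos Ds j i) 8, vert_at Ds j i,
        vert_at Ds j (next_pos Ds j i)} \<subseteq> verts (SemiBlowup G Ds)"
      using link(2) next_pos_in[OF link(2)] vert_at_verts by (force simp: SemiBlowup_simps copy_verts_eq)
    then have "X \<subseteq> verts (SemiBlowup G Ds)" using link(3) by auto
    moreover have "card X = 2" using link(3) by auto
    ultimately show ?thesis using link(1) by (simp add: SemiBlowup_simps(3) blow_ends_def)
  qed
  then show "ends (SemiBlowup G Ds) x \<subseteq> verts (SemiBlowup G Ds)" "card (ends (SemiBlowup G Ds) x) = 2"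
    by auto
qed

lemma is_graph_Blowup: "is_graph (Blowup G Ds)"
  unfolding is_graph_def
proof (intro conjI ballI)
  show "finite (verts (Blowup G Ds))" "finite (edges (Blowup G Ds))"
    using finite_positions graph
    by (auto simp: Blowup_simps is_graph_def copy_verts_eq copy_edges_eq)
next
  fix x assume "x \<in> edges (Blowup G Ds)"
  then consider (kept) e where "x = Kept e" "e \<in> edges G"
    | (copy) j i X where "x = Added X" "(j, i) \<in> positions Ds" "X \<in> copy_edges j i"
    | (link) j i X where "x = Added X" "(j, i) \<in> positions Ds"
      "X \<in> {{vert_at Ds j i, NewU j i}, {vert_at Ds j i, NewW j i},
        {NewU j i, InCopy j i 7}, {NewW j i, InCopy j i 8},
        {InCopy j i 1, NewU j (next_pos Ds j i)}, {InCopy j i 4, NewW j (next_pos Ds j i)}}"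
    unfolding Blowup_simps by blast
  then have "ends (Blowup G Ds) x \<subseteq> verts (Blowup G Ds) \<and> card (ends (Blowup G Ds) x) = 2"
  proof cases
    case kept
    then show ?thesis using kept_ends[of e] by (auto simp: Blowup_simps)
  next
    case copy
    then show ?thesis using copy_edges_verts[of X j i] copy_edges_card[of X j i]
      by (auto simp: Blowup_simps blow_ends_def)
  next
    case link
    have "{InCopy j i 1, InCopy j i 4, InCopy j i 7, InCopy j i 8, vert_at Ds j i, NewU j i, NewW j i,
        NewU j (next_pos Ds j i), NewW j (next_pos Ds j i)} \<subseteq> verts (Blowup G Ds)"
      using link(2) next_pos_in[OF link(2)] vert_at_verts by (force simp: Blowup_simps copy_verts_eq)
    then have "X \<subseteq> verts (Blowup G Ds)" using link(3) by auto
    moreover have "card X = 2" using link(3) by auto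
    ultimately show ?thesis using link(1) by (simp add: Blowup_simps(3) blow_ends_def)
  qed
  then show "ends (Blowup G Ds) x \<subseteq> verts (Blowup G Ds)" "card (ends (Blowup G Ds) x) = 2"
    by auto
qed

section \<open>Vertices of the blown-up graphs have degree at most 3\<close>

text \<open>The link at foot \<open>p\<close> of a copy. The last branch is meant for foot 8, whose
  link comes from \<open>a2\<close> of the previous copy; it is also the default for vertices that
  are no foot.\<close>

definition semi_link_at :: "nat \<Rightarrow> nat \<Rightarrow> nat \<Rightarrow> 'v blow_vert set" where
  "semi_link_at j i p =
     (if p = 1 then {InCopy j i 1, vert_at Ds j (next_pos Ds j i)}
      else if p = 4 then {InCopy j i 4, InCopy j (next_pos Ds j i) 8}
      else if p = 7 then {vert_at Ds j i, InCopy j i 7}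
      else {InCopy j (prev_pos Ds j i) 4, InCopy j i 8})"

definition full_link_at :: "nat \<Rightarrow> nat \<Rightarrow> nat \<Rightarrow> 'v blow_vert set" where
  "full_link_at j i p =
     (if p = 1 then {InCopy j i 1, NewU j (next_pos Ds j i)}
      else if p = 4 then {InCopy j i 4, NewW j (next_pos Ds j i)}
      else if p = 7 then {NewU j i, InCopy j i 7}
      else {NewW j i, InCopy j i 8})"

text \<open>A foot has two neighbors inside the copy and at most the one link \<open>e\<close>; any
  other vertex of the copy has three neighbors inside and no link.\<close>

lemma degree_at_copy:
  fixes H :: "('v blow_vert, ('v, 'e) blow_edge) multigraph"
  assumes p: "p \<in> verts pole_B"
    and inc: "\<And>x. x \<in> incident H (InCopy j i p) \<Longrightarrow>
      (\<exists>X. x = Added X \<and> X \<in> copy_edges j i \<and> InCopy j i p \<in> X) \<or> p \<in> {1, 4, 7, 8} \<and> x = e"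
  shows "degree H (InCopy j i p) \<le> 3"
proof -
  define N where "N = {q. {p, q} \<in> edges pole_B}"
  define E where "E = (if p \<in> {1, 4, 7, 8} then {e} else {})"
  define f :: "nat \<Rightarrow> ('v, 'e) blow_edge" where "f q = Added {InCopy j i p, InCopy j i q}" for q
  have fin: "finite N" "finite E" using finite_pole_B_neighbours by (auto simp: N_def E_def)
  have "incident H (InCopy j i p) \<subseteq> f ` N \<union> E"
  proof
    fix x assume "x \<in> incident H (InCopy j i p)"
    from inc[OF this] show "x \<in> f ` N \<union> E"
    proof
      assume "\<exists>X. x = Added X \<and> X \<in> copy_edges j i \<and> InCopy j i p \<in> X"
      then show ?thesis by (auto simp: N_def f_def elim: copy_edges_at)
    next
      assume "p \<in> {1, 4, 7, 8} \<and> x = e"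
      then show ?thesis unfolding E_def by simp
    qed
  qed
  then have "card (incident H (InCopy j i p)) \<le> card (f ` N \<union> E)"
    using fin by (intro card_mono) auto
  also have "\<dots> \<le> card N + card E"
    using card_Un_le[of "f ` N" E] card_image_le[OF fin(1), of f] by linarith
  also have "\<dots> = 3" using pole_B_degree[OF p] by (simp add: N_def E_def)
  finally show ?thesis by (simp add: degree_def incident_def)
qed

text \<open>A vertex off the cycles has only kept edges. On a cycle, its two cycle edges are
  replaced by at most two added edges \<open>a\<close> and \<open>b\<close>, next to the single kept
  edge.\<close>

lemma degree_at_old:
  assumes v: "v \<in> verts G"
    and off: "v \<notin> verts D \<Longrightarrow> incident H (Old v) \<subseteq> Kept ` incident G v"
    and on: "\<And>j i e. \<lbrakk>(j, i) \<in> positions Ds; Old v = vert_at Ds j i;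
        {e \<in> edges G - edges D. v \<in> ends G e} = {e}\<rbrakk> \<Longrightarrow> \<exists>a b. incident H (Old v) \<subseteq> {Kept e, a, b}"
  shows "degree H (Old v) \<le> 3"
proof (cases "v \<in> verts D")
  case True
  then obtain j i e where "(j, i) \<in> positions Ds" "Old v = vert_at Ds j i"
    "{e \<in> edges G - edges D. v \<in> ends G e} = {e}"
    using verts_D_E kept_at by metis
  then obtain a b where "incident H (Old v) \<subseteq> {Kept e, a, b}" using on by blast
  then show ?thesis by (rule degree_le_3I)
next
  case False
  have "card (incident H (Old v)) \<le> card (incident G v)"
    using off[OF False] finite_incident[OF graph] by (rule surj_card_le[rotated])
  then show ?thesis using v cubic by (simp add: regular_def degree_def incident_def)
qed

lemma incident_SemiBlowup_cases:
  assumes "x \<in> incident (SemiBlowup G Ds) w"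
  obtains (kept) e v where "x = Kept e" "w = Old v" "e \<in> edges G - edges D" "v \<in> ends G e"
  | (copy) j i X where "x = Added X" "(j, i) \<in> positions Ds" "X \<in> copy_edges j i" "w \<in> X"
  | (b1) j i where "x = Added {vert_at Ds j i, InCopy j i 7}" "(j, i) \<in> positions Ds"
      "w = vert_at Ds j i \<or> w = InCopy j i 7"
  | (ab) j i where "x = Added {InCopy j i 4, InCopy j (next_pos Ds j i) 8}" "(j, i) \<in> positions Ds"
      "w = InCopy j i 4 \<or> w = InCopy j (next_pos Ds j i) 8"
  | (a1) j i where "x = Added {InCopy j i 1, vert_at Ds j (next_pos Ds j i)}" "(j, i) \<in> positions Ds"
      "w = InCopy j i 1 \<or> w = vert_at Ds j (next_pos Ds j i)"
proof -
  have x: "x \<in> edges (SemiBlowup G Ds)" "w \<in> blow_ends G x"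
    using assms by (auto simp: incident_def SemiBlowup_simps(3))
  show ?thesis
    using x(1) unfolding SemiBlowup_simps(2)
  proof
    assume "x \<in> Kept ` (edges G - edges D)"
    then show ?thesis using kept x(2) by (auto simp: blow_ends_def)
  next
    assume "x \<in> Added ` (\<Union>(j, i)\<in>positions Ds. copy_edges j i \<union>
       {{vert_at Ds j i, InCopy j i 7}, {InCopy j i 4, InCopy j (next_pos Ds j i) 8},
        {InCopy j i 1, vert_at Ds j (next_pos Ds j i)}})"
    then obtain j i X where X: "x = Added X" "(j, i) \<in> positions Ds" "X \<in> copy_edges j i \<or>
       X = {vert_at Ds j i, InCopy j i 7} \<or> X = {InCopy j i 4, InCopy j (next_pos Ds j i) 8} \<or>
       X = {InCopy j i 1, vert_at Ds j (next_pos Ds j i)}"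
      by blast
    have w: "w \<in> X" using x(2) X(1) by (simp add: blow_ends_def)
    from X(3) show ?thesis
    proof (elim disjE)
      assume "X \<in> copy_edges j i"
      then show ?thesis by (rule copy[OF X(1,2) _ w])
    next
      assume "X = {vert_at Ds j i, InCopy j i 7}"
      then show ?thesis using b1[of j i] X(1,2) w by auto
    next
      assume "X = {InCopy j i 4, InCopy j (next_pos Ds j i) 8}"
      then show ?thesis using ab[of j i] X(1,2) w by auto
    next
      assume "X = {InCopy j i 1, vert_at Ds j (next_pos Ds j i)}"
      then show ?thesis using a1[of j i] X(1,2) w by auto
    qed
  qed
qed

lemma incident_Blowup_cases:
  assumes "x \<in> incident (Blowup G Ds) w"
  obtains (kept) e v where "x = Kept e" "w = Old v" "e \<in> edges G - edges D" "v \<in> ends G e"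
  | (copy) j i X where "x = Added X" "(j, i) \<in> positions Ds" "X \<in> copy_edges j i" "w \<in> X"
  | (u) j i where "x = Added {vert_at Ds j i, NewU j i}" "(j, i) \<in> positions Ds"
      "w = vert_at Ds j i \<or> w = NewU j i"
  | (w) j i where "x = Added {vert_at Ds j i, NewW j i}" "(j, i) \<in> positions Ds"
      "w = vert_at Ds j i \<or> w = NewW j i"
  | (b1) j i where "x = Added {NewU j i, InCopy j i 7}" "(j, i) \<in> positions Ds"
      "w = NewU j i \<or> w = InCopy j i 7"
  | (b2) j i where "x = Added {NewW j i, InCopy j i 8}" "(j, i) \<in> positions Ds"
      "w = NewW j i \<or> w = InCopy j i 8"
  | (a1) j i where "x = Added {InCopy j i 1, NewU j (next_pos Ds j i)}" "(j, i) \<in> positions Ds"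
      "w = InCopy j i 1 \<or> w = NewU j (next_pos Ds j i)"
  | (a2) j i where "x = Added {InCopy j i 4, NewW j (next_pos Ds j i)}" "(j, i) \<in> positions Ds"
      "w = InCopy j i 4 \<or> w = NewW j (next_pos Ds j i)"
proof -
  have x: "x \<in> edges (Blowup G Ds)" "w \<in> blow_ends G x"
    using assms by (auto simp: incident_def Blowup_simps(3))
  show ?thesis
    using x(1) unfolding Blowup_simps(2)
  proof
    assume "x \<in> Kept ` (edges G - edges D)"
    then show ?thesis using kept x(2) by (auto simp: blow_ends_def)
  next
    assume "x \<in> Added ` (\<Union>(j, i)\<in>positions Ds. copy_edges j i \<union>
       {{vert_at Ds j i, NewU j i}, {vert_at Ds j i, NewW j i},
        {NewU j i, InCopy j i 7}, {NewW j i, InCopy j i 8},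
        {InCopy j i 1, NewU j (next_pos Ds j i)}, {InCopy j i 4, NewW j (next_pos Ds j i)}})"
    then obtain j i X where X: "x = Added X" "(j, i) \<in> positions Ds" "X \<in> copy_edges j i \<or>
       X = {vert_at Ds j i, NewU j i} \<or> X = {vert_at Ds j i, NewW j i} \<or>
       X = {NewU j i, InCopy j i 7} \<or> X = {NewW j i, InCopy j i 8} \<or>
       X = {InCopy j i 1, NewU j (next_pos Ds j i)} \<or> X = {InCopy j i 4, NewW j (next_pos Ds j i)}"
      by blast
    have wX: "w \<in> X" using x(2) X(1) by (simp add: blow_ends_def)
    from X(3) show ?thesis
    proof (elim disjE)
      assume "X \<in> copy_edges j i"
      then show ?thesis by (rule copy[OF X(1,2) _ wX])
    next
      assume "X = {vert_at Ds j i, NewU j i}"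
      then show ?thesis using u[of j i] X(1,2) wX by auto
    next
      assume "X = {vert_at Ds j i, NewW j i}"
      then show ?thesis using w[of j i] X(1,2) wX by auto
    next
      assume "X = {NewU j i, InCopy j i 7}"
      then show ?thesis using b1[of j i] X(1,2) wX by auto
    next
      assume "X = {NewW j i, InCopy j i 8}"
      then show ?thesis using b2[of j i] X(1,2) wX by auto
    next
      assume "X = {InCopy j i 1, NewU j (next_pos Ds j i)}"
      then show ?thesis using a1[of j i] X(1,2) wX by auto
    next
      assume "X = {InCopy j i 4, NewW j (next_pos Ds j i)}"
      then show ?thesis using a2[of j i] X(1,2) wX by auto
    qed
  qed
qed

lemma next_pos_iff:
  assumes "(j, i) \<in> positions Ds" "(j, i') \<in> positions Ds"
  shows "next_pos Ds j i' = i \<longleftrightarrow> i' = prev_pos Ds j i"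
  using assms next_pos_eq_iff by (auto simp: positions_def)

lemma degree_SemiBlowup:
  assumes "w \<in> verts (SemiBlowup G Ds)"
  shows "degree (SemiBlowup G Ds) w \<le> 3"
proof -
  consider v where "w = Old v" "v \<in> verts G"
    | j i p where "w = InCopy j i p" "(j, i) \<in> positions Ds" "p \<in> verts pole_B"
    using assms unfolding SemiBlowup_simps copy_verts_def by blast
  then show ?thesis
  proof cases
    case 1
    show ?thesis unfolding 1
    proof (rule degree_at_old[OF 1(2)])
      assume "v \<notin> verts D"
      then have no: "Old v \<noteq> vert_at Ds j i" if "(j, i) \<in> positions Ds" for j i
        using vert_at_in[OF that] by (auto simp: vert_at_def)
      show "incident (SemiBlowup G Ds) (Old v) \<subseteq> Kept ` incident G v"
      proof
        fix x assume "x \<in> incident (SemiBlowup G Ds) (Old v)"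
        then show "x \<in> Kept ` incident G v"
        proof (cases rule: incident_SemiBlowup_cases)
          case (kept e v')
          then show ?thesis by (auto simp: incident_def)
        next
          case (copy j i X)
          then show ?thesis using not_in_copy_edges(1)[OF copy(3)] by simp
        next
          case (b1 j i)
          then show ?thesis using no[OF b1(2)] by simp
        next
          case (ab j i)
          then show ?thesis using no[OF ab(2)] by simp
        next
          case (a1 j i)
          then show ?thesis using no[OF next_pos_in[OF a1(2)]] by simp
        qed
      qed
    next
      fix j i e assume ji: "(j, i) \<in> positions Ds" and v: "Old v = vert_at Ds j i"
        and e: "{e \<in> edges G - edges D. v \<in> ends G e} = {e}"
      \<comment> \<open>Besides the kept edge, the vertex receives \<open>b1\<close> of its own copy
        and \<open>a1\<close> of the preceding one.\<close>
      have "incident (SemiBlowup G Ds) (Old v) \<subseteq> {Kept e, Added {vert_at Ds j i, InCopy j i 7},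
          Added {InCopy j (prev_pos Ds j i) 1, vert_at Ds j i}}"
      proof
        fix x assume "x \<in> incident (SemiBlowup G Ds) (Old v)"
        then show "x \<in> {Kept e, Added {vert_at Ds j i, InCopy j i 7},
          Added {InCopy j (prev_pos Ds j i) 1, vert_at Ds j i}}"
        proof (cases rule: incident_SemiBlowup_cases)
          case (kept e' v')
          then show ?thesis using e by auto
        next
          case (copy j' i' X)
          then show ?thesis using not_in_copy_edges(1)[OF copy(3)] by simp
        next
          case (b1 j' i')
          then show ?thesis using vert_at_eq_iff[OF ji b1(2)] v by auto
        next
          case (ab j' i')
          then show ?thesis by auto
        next
          case (a1 j' i')
          then have "vert_at Ds j' (next_pos Ds j' i') = vert_at Ds j i" using v by auto
          then show ?thesis using vert_at_next_iff[OF ji a1(2)] a1 by auto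
        qed
      qed
      then show "\<exists>a b. incident (SemiBlowup G Ds) (Old v) \<subseteq> {Kept e, a, b}" by blast
    qed
  next
    case 2
    show ?thesis unfolding 2
    proof (rule degree_at_copy[OF 2(3)])
      fix x assume "x \<in> incident (SemiBlowup G Ds) (InCopy j i p)"
      then show "(\<exists>X. x = Added X \<and> X \<in> copy_edges j i \<and> InCopy j i p \<in> X) \<or>
        p \<in> {1, 4, 7, 8} \<and> x = Added (semi_link_at j i p)"
      proof (cases rule: incident_SemiBlowup_cases)
        case (copy j' i' X)
        then show ?thesis using copy_edges_subset[of X j' i'] by auto
      next
        \<comment> \<open>This link meets the copy either at foot 4 of its own position or at foot 8
          as the link of the preceding position.\<close>
        case (ab j' i')
        then show ?thesis using next_pos_iff[of j i i'] 2(2) by (auto simp: semi_link_at_def)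
      qed (auto simp: semi_link_at_def)
    qed
  qed
qed

lemma degree_Blowup:
  assumes "w \<in> verts (Blowup G Ds)"
  shows "degree (Blowup G Ds) w \<le> 3"
proof -
  consider v where "w = Old v" "v \<in> verts G"
    | j i p where "w = InCopy j i p" "(j, i) \<in> positions Ds" "p \<in> verts pole_B"
    | j i where "w = NewU j i" "(j, i) \<in> positions Ds"
    | j i where "w = NewW j i" "(j, i) \<in> positions Ds"
    using assms unfolding Blowup_simps copy_verts_def by blast
  then show ?thesis
  proof cases
    case 1
    show ?thesis unfolding 1
    proof (rule degree_at_old[OF 1(2)])
      assume "v \<notin> verts D"
      then have no: "Old v \<noteq> vert_at Ds j i" if "(j, i) \<in> positions Ds" for j i
        using vert_at_in[OF that] by (auto simp: vert_at_def)
      show "incident (Blowup G Ds) (Old v) \<subseteq> Kept ` incident G v"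
      proof
        fix x assume "x \<in> incident (Blowup G Ds) (Old v)"
        then show "x \<in> Kept ` incident G v"
        proof (cases rule: incident_Blowup_cases)
          case (kept e v')
          then show ?thesis by (auto simp: incident_def)
        next
          case (copy j i X)
          then show ?thesis using not_in_copy_edges(1)[OF copy(3)] by simp
        next
          case (u j i)
          then show ?thesis using no[OF u(2)] by simp
        next
          case (w j i)
          then show ?thesis using no[OF w(2)] by simp
        qed simp_all
      qed
    next
      fix j i e assume ji: "(j, i) \<in> positions Ds" and v: "Old v = vert_at Ds j i"
        and e: "{e \<in> edges G - edges D. v \<in> ends G e} = {e}"
      have "incident (Blowup G Ds) (Old v) \<subseteq>
          {Kept e, Added {vert_at Ds j i, NewU j i}, Added {vert_at Ds j i, NewW j i}}"
      proof
        fix x assume "x \<in> incident (Blowup G Ds) (Old v)"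
        then show "x \<in> {Kept e, Added {vert_at Ds j i, NewU j i}, Added {vert_at Ds j i, NewW j i}}"
        proof (cases rule: incident_Blowup_cases)
          case (kept e' v')
          then show ?thesis using e by auto
        next
          case (copy j' i' X)
          then show ?thesis using not_in_copy_edges(1)[OF copy(3)] by simp
        next
          case (u j' i')
          then show ?thesis using vert_at_eq_iff[OF ji u(2)] v by auto
        next
          case (w j' i')
          then show ?thesis using vert_at_eq_iff[OF ji w(2)] v by auto
        qed auto
      qed
      then show "\<exists>a b. incident (Blowup G Ds) (Old v) \<subseteq> {Kept e, a, b}" by blast
    qed
  next
    case 2
    show ?thesis unfolding 2
    proof (rule degree_at_copy[OF 2(3)])
      fix x assume "x \<in> incident (Blowup G Ds) (InCopy j i p)"
      then show "(\<exists>X. x = Added X \<and> X \<in> copy_edges j i \<and> InCopy j i p \<in> X) \<or>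
        p \<in> {1, 4, 7, 8} \<and> x = Added (full_link_at j i p)"
      proof (cases rule: incident_Blowup_cases)
        case (copy j' i' X)
        then show ?thesis using copy_edges_subset[of X j' i'] by auto
      qed (auto simp: full_link_at_def)
    qed
  next
    case 3
    \<comment> \<open>The neighbors of \<open>u\<close> are its cycle vertex, \<open>b1\<close> of
      its own copy and \<open>a1\<close> of the preceding one.\<close>
    have "incident (Blowup G Ds) w \<subseteq> {Added {vert_at Ds j i, NewU j i},
        Added {NewU j i, InCopy j i 7}, Added {InCopy j (prev_pos Ds j i) 1, NewU j i}}"
    proof
      fix x assume "x \<in> incident (Blowup G Ds) w"
      then show "x \<in> {Added {vert_at Ds j i, NewU j i},
        Added {NewU j i, InCopy j i 7}, Added {InCopy j (prev_pos Ds j i) 1, NewU j i}}"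
      proof (cases rule: incident_Blowup_cases)
        case (copy j' i' X)
        then show ?thesis using not_in_copy_edges(2)[OF copy(3)] 3 by simp
      next
        case (a1 j' i')
        then show ?thesis using next_pos_iff[of j i i'] 3 by auto
      qed (use 3 in auto)
    qed
    then show ?thesis by (rule degree_le_3I)
  next
    case 4
    have "incident (Blowup G Ds) w \<subseteq> {Added {vert_at Ds j i, NewW j i},
        Added {NewW j i, InCopy j i 8}, Added {InCopy j (prev_pos Ds j i) 4, NewW j i}}"
    proof
      fix x assume "x \<in> incident (Blowup G Ds) w"
      then show "x \<in> {Added {vert_at Ds j i, NewW j i},
        Added {NewW j i, InCopy j i 8}, Added {InCopy j (prev_pos Ds j i) 4, NewW j i}}"
      proof (cases rule: incident_Blowup_cases)
        case (copy j' i' X)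
        then show ?thesis using not_in_copy_edges(3)[OF copy(3)] 4 by simp
      next
        case (a2 j' i')
        then show ?thesis using next_pos_iff[of j i i'] 4 by auto
      qed (use 4 in auto)
    qed
    then show ?thesis by (rule degree_le_3I)
  qed
qed

section \<open>Each zone must lose an edge\<close>

lemma added_SemiBlowup:
  assumes "(j, i) \<in> positions Ds"
    and "X \<in> copy_edges j i \<union> {{vert_at Ds j i, InCopy j i 7},
      {InCopy j i 4, InCopy j (next_pos Ds j i) 8}, {InCopy j i 1, vert_at Ds j (next_pos Ds j i)}}"
  shows "Added X \<in> edges (SemiBlowup G Ds)"
  unfolding SemiBlowup_simps(2)
  by (rule UnI2, rule imageI, rule UN_I[OF assms(1)], simp only: prod.case, rule assms(2))

lemma added_Blowup:
  assumes "(j, i) \<in> positions Ds"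
    and "X \<in> copy_edges j i \<union> {{vert_at Ds j i, NewU j i}, {vert_at Ds j i, NewW j i},
      {NewU j i, InCopy j i 7}, {NewW j i, InCopy j i 8},
      {InCopy j i 1, NewU j (next_pos Ds j i)}, {InCopy j i 4, NewW j (next_pos Ds j i)}}"
  shows "Added X \<in> edges (Blowup G Ds)"
  unfolding Blowup_simps(2)
  by (rule UnI2, rule imageI, rule UN_I[OF assms(1)], simp only: prod.case, rule assms(2))

lemma semi_links_edges:
  assumes "(j, i) \<in> positions Ds" "X \<in> semi_links Ds j i"
  shows "Added X \<in> edges (SemiBlowup G Ds)"
  using assms(2) unfolding semi_links_def insert_iff empty_iff
  by (elim disjE FalseE)
    (simp_all add: added_SemiBlowup[OF assms(1)] added_SemiBlowup[OF next_pos_in[OF assms(1)]])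

lemma full_links_edges:
  assumes "(j, i) \<in> positions Ds" "X \<in> full_links Ds j i"
  shows "Added X \<in> edges (Blowup G Ds)"
  using assms(2) unfolding full_links_def insert_iff empty_iff
  by (elim disjE FalseE)
    (simp_all add: added_Blowup[OF assms(1)] added_Blowup[OF next_pos_in[OF assms(1)]])

text \<open>Two kinds of link contain a vertex of the original graph. The link from
  \<open>a2\<close> to \<open>b2\<close> joins different copies because cycles have length at least
  2, so the next position is another one.\<close>

lemma semi_links_not_copy:
  assumes "(j, i) \<in> positions Ds" "X \<in> semi_links Ds j i"
  shows "X \<notin> copy_edges j' i'"
proof
  assume copy: "X \<in> copy_edges j' i'"
  have "(\<exists>v. Old v \<in> X) \<or> InCopy j i 4 \<in> X \<and> InCopy j (next_pos Ds j i) 8 \<in> X"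
    using assms(2) unfolding semi_links_def vert_at_def insert_iff empty_iff by (elim disjE) simp_all
  then show False
  proof
    assume "\<exists>v. Old v \<in> X"
    then show False using not_in_copy_edges(1)[OF copy] by blast
  next
    assume "InCopy j i 4 \<in> X \<and> InCopy j (next_pos Ds j i) 8 \<in> X"
    then have "i = i'" "next_pos Ds j i = i'" using copy_edges_subset[OF copy] by blast+
    then show False using next_pos_neq[OF assms(1)] by simp
  qed
qed

lemma full_links_not_copy:
  assumes "X \<in> full_links Ds j i"
  shows "X \<notin> copy_edges j' i'"
proof
  assume "X \<in> copy_edges j' i'"
  from copy_edges_subset[OF this] show False
    using assms by (auto simp: full_links_def)
qed

text \<open>Each link contains a foot 1, 4 or 7, and that foot reveals its position: directly for 1
  and 4, through the injective successor for 7. Foot 8 occurs only together with foot 4.\<close>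

lemma semi_links_witness:
  assumes "X \<in> semi_links Ds j i"
  shows "InCopy j i 1 \<in> X \<or> InCopy j i 4 \<in> X \<or> InCopy j (next_pos Ds j i) 7 \<in> X"
    and "InCopy j' i' 1 \<in> X \<Longrightarrow> j' = j \<and> i' = i"
    and "InCopy j' i' 4 \<in> X \<Longrightarrow> j' = j \<and> i' = i"
    and "InCopy j' i' 7 \<in> X \<Longrightarrow> j' = j \<and> i' = next_pos Ds j i"
  using assms unfolding semi_links_def by auto

lemma full_links_witness:
  assumes "X \<in> full_links Ds j i"
  shows "NewU j (next_pos Ds j i) \<in> X \<or> NewW j (next_pos Ds j i) \<in> X"
    and "NewU j' i' \<in> X \<Longrightarrow> j' = j \<and> i' = next_pos Ds j i"
    and "NewW j' i' \<in> X \<Longrightarrow> j' = j \<and> i' = next_pos Ds j i"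
  using assms unfolding full_links_def by auto

lemma semi_links_disjoint:
  assumes pos: "(j, i) \<in> positions Ds" "(j', i') \<in> positions Ds"
    and X: "X \<in> semi_links Ds j i" "X \<in> semi_links Ds j' i'"
  shows "j = j' \<and> i = i'"
proof -
  have "j = j' \<and> (i = i' \<or> next_pos Ds j i = next_pos Ds j i')"
    using semi_links_witness(1)[OF X(1)] semi_links_witness(2-4)[OF X(2)] by metis
  then show ?thesis using next_pos_inj[of j i i'] pos by metis
qed

lemma full_links_disjoint:
  assumes pos: "(j, i) \<in> positions Ds" "(j', i') \<in> positions Ds"
    and X: "X \<in> full_links Ds j i" "X \<in> full_links Ds j' i'"
  shows "j = j' \<and> i = i'"
proof -
  have "j = j' \<and> next_pos Ds j i = next_pos Ds j i'"
    using full_links_witness(1)[OF X(1)] full_links_witness(2-3)[OF X(2)] by metis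
  then show ?thesis using next_pos_inj[of j i i'] pos by metis
qed

text \<open>Only the \<open>a\<close> semiedges of the first copy and the \<open>b\<close> semiedges
  of the second enter the argument, and all of them are links of this zone.\<close>

lemma SemiBlowup_zone:
  assumes c: "edge_coloring 3 (delete_edges (SemiBlowup G Ds) F) c"
    and pos: "(j, i) \<in> positions Ds"
  shows "F \<inter> Added ` (copy_edges j i \<union> copy_edges j (next_pos Ds j i) \<union> semi_links Ds j i) \<noteq> {}"
proof
  assume F: "F \<inter> Added ` (copy_edges j i \<union> copy_edges j (next_pos Ds j i) \<union> semi_links Ds j i) = {}"
  define n where "n = next_pos Ds j i"
  let ?H = "delete_edges (SemiBlowup G Ds) F"
  have copy_edge: "Added X \<in> edges ?H" if "X \<in> copy_edges j i \<or> X \<in> copy_edges j n" for X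
  proof -
    have "Added X \<notin> F" using that F unfolding n_def by blast
    moreover have "Added X \<in> edges (SemiBlowup G Ds)"
      using that added_SemiBlowup[OF pos] added_SemiBlowup[OF next_pos_in[OF pos]]
      unfolding n_def by (elim disjE) (simp_all only: UnI1)
    ultimately show ?thesis by simp
  qed
  then have copy: "Added ` copy_edges j i \<subseteq> edges ?H" "Added ` copy_edges j n \<subseteq> edges ?H"
    by blast+
  have link: "Added X \<in> edges ?H - Added ` copy_edges j' i'" if "X \<in> semi_links Ds j i" for X j' i'
    using that F semi_links_edges[OF pos that] semi_links_not_copy[OF pos that] by auto
  have mem: "{vert_at Ds j n, InCopy j n 7} \<in> semi_links Ds j i"
    "{InCopy j i 4, InCopy j n 8} \<in> semi_links Ds j i"
    "{InCopy j i 1, vert_at Ds j n} \<in> semi_links Ds j i"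
    by (simp_all add: semi_links_def n_def)
  have H: "ends ?H = blow_ends G" by (simp add: SemiBlowup_simps)
  \<comment> \<open>The link from \<open>a2\<close> to \<open>b2\<close> is a semiedge of both
    copies, so it transports the color from one side of the cycle vertex to the other.\<close>
  have "c (Added {InCopy j i 1, vert_at Ds j n}) = c (Added {InCopy j i 4, InCopy j n 8})"
    by (rule copy_semiedge_colors(1)[OF c H copy(1) link[OF mem(3)] link[OF mem(2)]])
      (simp_all add: blow_ends_def)
  moreover have "c (Added {vert_at Ds j n, InCopy j n 7}) = c (Added {InCopy j i 4, InCopy j n 8})"
    by (rule copy_semiedge_colors(2)[OF c H copy(2) link[OF mem(1)] link[OF mem(2)]])
      (simp_all add: blow_ends_def)
  \<comment> \<open>The two edges meet at the cycle vertex between the copies.\<close>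
  moreover have "c (Added {InCopy j i 1, vert_at Ds j n}) \<noteq> c (Added {vert_at Ds j n, InCopy j n 7})"
  proof (rule edge_coloringD[OF c])
    show "vert_at Ds j n \<in> ends ?H (Added {InCopy j i 1, vert_at Ds j n})"
      "vert_at Ds j n \<in> ends ?H (Added {vert_at Ds j n, InCopy j n 7})"
      unfolding H by (simp_all add: blow_ends_def)
  qed (use link mem in \<open>auto simp: doubleton_eq_iff\<close>)
  ultimately show False by simp
qed

text \<open>The two copies make the colors at \<open>u\<close> and at \<open>w\<close> agree: the
  edges to \<open>a1\<close> and \<open>a2\<close> have one color, those to \<open>b1\<close> and
  \<open>b2\<close> another. Hence \<open>vu\<close> and \<open>vw\<close> are left with the same
  third color, although they meet at \<open>v\<close>.\<close>

lemma Blowup_zone: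
  assumes c: "edge_coloring 3 (delete_edges (Blowup G Ds) F) c"
    and pos: "(j, i) \<in> positions Ds"
  shows "F \<inter> Added ` (copy_edges j i \<union> copy_edges j (next_pos Ds j i) \<union> full_links Ds j i) \<noteq> {}"
proof
  assume F: "F \<inter> Added ` (copy_edges j i \<union> copy_edges j (next_pos Ds j i) \<union> full_links Ds j i) = {}"
  define n where "n = next_pos Ds j i"
  let ?H = "delete_edges (Blowup G Ds) F"
  let ?v = "vert_at Ds j n" and ?u = "NewU j n" and ?w = "NewW j n"
  let ?a1 = "InCopy j i 1" and ?a2 = "InCopy j i 4" and ?b1 = "InCopy j n 7" and ?b2 = "InCopy j n 8"
  have copy_edge: "Added X \<in> edges ?H" if "X \<in> copy_edges j i \<or> X \<in> copy_edges j n" for X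
  proof -
    have "Added X \<notin> F" using that F unfolding n_def by blast
    moreover have "Added X \<in> edges (Blowup G Ds)"
      using that added_Blowup[OF pos] added_Blowup[OF next_pos_in[OF pos]]
      unfolding n_def by (elim disjE) (simp_all only: UnI1)
    ultimately show ?thesis by simp
  qed
  then have copy: "Added ` copy_edges j i \<subseteq> edges ?H" "Added ` copy_edges j n \<subseteq> edges ?H"
    by blast+
  have link: "Added X \<in> edges ?H - Added ` copy_edges j' i'" if "X \<in> full_links Ds j i" for X j' i'
    using that F full_links_edges[OF pos that] full_links_not_copy[OF that] by auto
  have mem: "{?v, ?u} \<in> full_links Ds j i" "{?v, ?w} \<in> full_links Ds j i"
    "{?u, ?b1} \<in> full_links Ds j i" "{?w, ?b2} \<in> full_links Ds j i"
    "{?a1, ?u} \<in> full_links Ds j i" "{?a2, ?w} \<in> full_links Ds j i"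
    by (simp_all add: full_links_def n_def)
  have H: "ends ?H = blow_ends G" by (simp add: Blowup_simps)
  have a: "c (Added {?a1, ?u}) = c (Added {?a2, ?w})"
    by (rule copy_semiedge_colors(1)[OF c H copy(1) link[OF mem(5)] link[OF mem(6)]])
      (simp_all add: blow_ends_def)
  have b: "c (Added {?u, ?b1}) = c (Added {?w, ?b2})"
    by (rule copy_semiedge_colors(2)[OF c H copy(2) link[OF mem(3)] link[OF mem(4)]])
      (simp_all add: blow_ends_def)
  have neq: "c (Added X) \<noteq> c (Added Y)" if "X \<in> full_links Ds j i" "Y \<in> full_links Ds j i" "X \<noteq> Y"
    "X \<inter> Y \<noteq> {}" for X Y
  proof -
    from that(4) obtain z where z: "z \<in> X" "z \<in> Y" by blast
    show ?thesis
    proof (rule edge_coloringD[OF c])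
      show "z \<in> ends ?H (Added X)" "z \<in> ends ?H (Added Y)"
        unfolding H using z by (simp_all add: blow_ends_def)
    qed (use link that in auto)
  qed
  have lt: "c (Added X) < 3" if "X \<in> full_links Ds j i" for X
    using c link[OF that] by (auto simp: edge_coloring_def)
  have "c (Added {?v, ?u}) \<noteq> c (Added {?u, ?b1})" "c (Added {?v, ?u}) \<noteq> c (Added {?a1, ?u})"
    "c (Added {?u, ?b1}) \<noteq> c (Added {?a1, ?u})"
    "c (Added {?v, ?w}) \<noteq> c (Added {?w, ?b2})" "c (Added {?v, ?w}) \<noteq> c (Added {?a2, ?w})"
    "c (Added {?v, ?u}) \<noteq> c (Added {?v, ?w})"
    by (rule neq; use mem in \<open>simp add: doubleton_eq_iff\<close>)+
  \<comment> \<open>The three edges at \<open>u\<close> use all colors, and the color of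
    \<open>vw\<close> differs from each of the three: from that of \<open>vu\<close> at
    \<open>v\<close>, from the other two at \<open>w\<close> by \<open>a\<close> and
    \<open>b\<close>.\<close>
  then show False
    using third_color[of "c (Added {?v, ?u})" "c (Added {?u, ?b1})" "c (Added {?a1, ?u})" "c (Added {?v, ?w})"]
      lt mem a b by metis
qed

text \<open>With nothing deleted, a coloring would require the empty set to meet the zone at
  position \<open>(0, 0)\<close>, which exists because there is a cycle and it is not empty.\<close>

lemma not_3_edge_colorable:
  fixes H :: "('v blow_vert, ('v, 'e) blow_edge) multigraph"
  assumes "Ds \<noteq> []"
    and zone: "\<And>F c j i. \<lbrakk>edge_coloring 3 (delete_edges H F) c; (j, i) \<in> positions Ds\<rbrakk>
      \<Longrightarrow> F \<inter> Z j i \<noteq> {}"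
  shows "\<not> edge_colorable 3 H"
proof
  assume "edge_colorable 3 H"
  then obtain c where "edge_coloring 3 (delete_edges H {}) c"
    by (auto simp: edge_colorable_iff delete_edges_def)
  moreover have "(0, 0) \<in> positions Ds" using length_ge_2[of 0] assms(1) by (auto simp: positions_def)
  ultimately show False using zone by blast
qed

end

theorem theorem2p5:
  fixes G D :: "('v, 'e) multigraph" and Ds :: "('v, 'e) cyc list"
  assumes "is_graph G" and "cubic G" and "edge_connected 3 G"
    and "subgraph D G" and "regular 2 D"
    and "cycles_of D Ds" and "length Ds \<ge> 1"
  shows "\<not> edge_colorable 3 (Blowup G Ds) \<and>
     \<not> edge_colorable 3 (SemiBlowup G Ds) \<and>
     oddness (Blowup G Ds) \<ge> enat (resistance (Blowup G Ds)) \<and>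
     int (resistance (Blowup G Ds)) \<ge> (\<Sum>i<length Ds. \<lceil>real (card (cyc_verts (Ds ! i))) / 2\<rceil>) \<and>
     oddness (SemiBlowup G Ds) \<ge> enat (resistance (SemiBlowup G Ds)) \<and>
     int (resistance (SemiBlowup G Ds)) \<ge> (\<Sum>i<length Ds. \<lceil>real (card (cyc_verts (Ds ! i))) / 2\<rceil>)"
proof -
  interpret blowup_data G D Ds using assms by unfold_locales
  have Ds: "Ds \<noteq> []" using assms(7) by auto
  show ?thesis
  proof (intro conjI)
    show "\<not> edge_colorable 3 (Blowup G Ds)" by (rule not_3_edge_colorable[OF Ds Blowup_zone])
    show "\<not> edge_colorable 3 (SemiBlowup G Ds)" by (rule not_3_edge_colorable[OF Ds SemiBlowup_zone])
    show "enat (resistance (Blowup G Ds)) \<le> oddness (Blowup G Ds)"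
      by (rule resistance_le_oddness[OF is_graph_Blowup degree_Blowup])
    show "enat (resistance (SemiBlowup G Ds)) \<le> oddness (SemiBlowup G Ds)"
      by (rule resistance_le_oddness[OF is_graph_SemiBlowup degree_SemiBlowup])
    show "(\<Sum>i<length Ds. \<lceil>real (card (cyc_verts (Ds ! i))) / 2\<rceil>) \<le> int (resistance (Blowup G Ds))"
      by (rule resistance_ge[OF is_graph_Blowup full_links_disjoint full_links_not_copy Blowup_zone])
    show "(\<Sum>i<length Ds. \<lceil>real (card (cyc_verts (Ds ! i))) / 2\<rceil>) \<le> int (resistance (SemiBlowup G Ds))"
      by (rule resistance_ge[OF is_graph_SemiBlowup semi_links_disjoint semi_links_not_copy SemiBlowup_zone])
  qed
qed

end
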